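(* Let $\mathfrak{A}$ be a (not necessarily unital, not necessarily commutative) $C^{*}$-algebra and let $\mathcal{P}:\mathfrak{A}\to\mathfrak{A}$ be a linear projection (i.e. a linear map with $\mathcal{P}^2=\mathcal{P}$) such that $\mathcal{P}^{*}[\mathcal{S}(\mathfrak{A})]\subset\mathcal{S}(\mathfrak{A})$, i.e. $\phi\circ\mathcal{P}$ is a state of $\mathfrak{A}$ for every state $\phi$ of $\mathfrak{A}$. Suppose that the image of $\mathcal{P}$ is a $C^{*}$-subalgebra $\mathfrak{B}\subset\mathfrak{A}$. Then $\mathcal{P}$ is a conditional expectation onto $\mathfrak{B}$.
   Context: All $C^{*}$-algebras are over $\mathbb{C}$. An element $G$ of a $C^{*}$-algebra $\mathfrak{A}$ is positive, $G\geq 0$, if $G=H^{*}H$ for some $H\in\mathfrak{A}$. An element $\phi$ of the Banach dual $\mathfrak{A}^{*}$ is positive if $\phi(G)\geq 0$ for all $G\geq 0$. A state of $\mathfrak{A}$ is a positive $\phi\in\mathfrak{A}^{*}$ with $\|\phi\|=1$; $\mathcal{S}(\mathfrak{A})\subset\mathfrak{A}^{*}$ denotes the set of states. For a linear map $\mathcal{P}$, $\mathcal{P}^{*}\phi:=\phi\circ\mathcal{P}$. A conditional expectation on $\mathfrak{A}$ onto a $C^{*}$-subalgebra $\mathfrak{B}\subset\mathfrak{A}$ is a linear projection $\mathcal{P}:\mathfrak{A}\to\mathfrak{A}$ with image equal to $\mathfrak{B}$ that is positive ($\mathcal{P}(G)\geq 0$ whenever $G\geq 0$), contractive ($\|\mathcal{P}(a)\|\leq\|a\|$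 for all $a\in\mathfrak{A}$), and satisfies $\mathcal{P}(bab')=b\,\mathcal{P}(a)\,b'$ for all $a\in\mathfrak{A}$ and $b,b'\in\mathfrak{B}$. *)

theory Defs
  imports "HOL-Analysis.Analysis"
begin

class complex_vector = real_vector +
  fixes scaleC :: "complex \<Rightarrow> 'a \<Rightarrow> 'a" (infixr \<open>*\<^sub>C\<close> 75)
  assumes scaleC_add_right: "c *\<^sub>C (x + y) = c *\<^sub>C x + c *\<^sub>C y"
    and scaleC_add_left: "(c + d) *\<^sub>C x = c *\<^sub>C x + d *\<^sub>C x"
    and scaleC_scaleC: "c *\<^sub>C (d *\<^sub>C x) = (c * d) *\<^sub>C x"
    and scaleC_one: "1 *\<^sub>C x = x"
    and scaleR_scaleC: "r *\<^sub>R x = complex_of_real r *\<^sub>C x"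

global_interpretation complex_vector: vector_space "scaleC :: complex \<Rightarrow> 'a \<Rightarrow> 'a :: complex_vector"
  by unfold_locales (simp_all add: scaleC_add_right scaleC_add_left scaleC_scaleC scaleC_one)

abbreviation clinear :: "('a::complex_vector \<Rightarrow> 'b::complex_vector) \<Rightarrow> bool" where
  "clinear \<equiv> Vector_Spaces.linear scaleC scaleC"

text \<open>No unit is required, and the zero algebra is allowed.  Completeness comes from
  \<^class>\<open>banach\<close>, submultiplicativity of the norm from \<^class>\<open>real_normed_algebra\<close>.\<close>

class cstar_algebra = complex_vector + real_normed_algebra + banach +
  fixes star :: "'a \<Rightarrow> 'a"
  assumes mult_scaleC_left: "(c *\<^sub>C x) * y = c *\<^sub>C (x * y)"
    and mult_scaleC_right: "x * (c *\<^sub>C y) = c *\<^sub>C (x * y)"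
    and norm_scaleC: "norm (c *\<^sub>C x) = cmod c * norm x"
    and star_star: "star (star x) = x"
    and star_add: "star (x + y) = star x + star y"
    and star_scaleC: "star (c *\<^sub>C x) = cnj c *\<^sub>C star x"
    and star_mult: "star (x * y) = star y * star x"
    and cstar_identity: "norm (star x * x) = (norm x)\<^sup>2"

instantiation complex :: cstar_algebra
begin

definition scaleC_complex_def: "scaleC = ((*) :: complex \<Rightarrow> complex \<Rightarrow> complex)"

definition star_complex_def: "star = cnj"

instance
  by standard
    (simp_all add: scaleC_complex_def star_complex_def algebra_simps scaleR_conv_of_real
      norm_mult power2_eq_square)

end

definition positive :: "'a::cstar_algebra \<Rightarrow> bool" where
  "positive G \<longleftrightarrow> (\<exists>H. G = star H * H)"

definition dual :: "('a::cstar_algebra \<Rightarrow> complex) set" where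
  "dual = {\<phi>. clinear \<phi> \<and> bounded_linear \<phi>}"

definition positive_functional :: "('a::cstar_algebra \<Rightarrow> complex) \<Rightarrow> bool" where
  "positive_functional \<phi> \<longleftrightarrow> \<phi> \<in> dual \<and> (\<forall>G. positive G \<longrightarrow> \<phi> G \<in> \<real>\<^sub>\<ge>\<^sub>0)"

definition states :: "('a::cstar_algebra \<Rightarrow> complex) set" where
  "states = {\<phi>. positive_functional \<phi> \<and> onorm \<phi> = 1}"

definition cstar_subalgebra :: "'a::cstar_algebra set \<Rightarrow> bool" where
  "cstar_subalgebra B \<longleftrightarrow>
     complex_vector.subspace B \<and> closed B \<and>
     (\<forall>a\<in>B. \<forall>b\<in>B. a * b \<in> B) \<and> (\<forall>a\<in>B. star a \<in> B)"

definition linear_projection :: "('a::complex_vector \<Rightarrow> 'a) \<Rightarrow> bool" where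
  "linear_projection P \<longleftrightarrow> clinear P \<and> P \<circ> P = P"

definition conditional_expectation :: "('a::cstar_algebra \<Rightarrow> 'a) \<Rightarrow> 'a set \<Rightarrow> bool" where
  "conditional_expectation P B \<longleftrightarrow>
     cstar_subalgebra B \<and> linear_projection P \<and> range P = B \<and>
     (\<forall>G. positive G \<longrightarrow> positive (P G)) \<and>
     (\<forall>a. norm (P a) \<le> norm a) \<and>
     (\<forall>a. \<forall>b\<in>B. \<forall>b'\<in>B. P (b * a * b') = b * P a * b')"

end

theory Submission
  imports Defs
begin

text \<open>Extend \<open>P\<close> to the unital map \<open>E (a + \<lambda>) = P a + \<lambda>\<close> on the unitization. A state of the
  unitization restricts to a positive functional on the algebra, composing with \<open>P\<close> keeps it positive
  of norm at most one, and such functionals extend back; as states detect positivity, \<open>E\<close> is positive.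
  Kadison's inequality \<open>E (x\<^sup>2) \<ge> (E x)\<^sup>2\<close> is an equality on the range of \<open>E\<close>, which gives
  \<open>E (b x + x b) = b E x + E x b\<close> for \<open>b\<close> in the range. For \<open>a\<close> in the kernel the map
  \<open>b \<mapsto> E (b a)\<close> then obeys the power rule of a derivation on powers \<open>w\<^sup>n\<close> of unitaries \<open>w\<close>, and being
  bounded it vanishes; hence \<open>E\<close> is a bimodule map over its range. Expanding \<open>E ((x - E x)\<^sup>* (x - E x)) \<ge> 0\<close> yields
  \<open>(E x)\<^sup>* E x \<le> E (x\<^sup>* x)\<close> and with it contractivity.\<close>

section \<open>Positive elements of unital $C^*$-algebras\<close>

text \<open>For positive maps Kadison's inequality is restricted to self-adjoint elements: its
  version with \<open>star x * x\<close> fails already for matrix transposition. This is why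
  equality in it yields only a Jordan identity. Positivity cannot give more: averaging a complex
  matrix with its transpose is a unital positive projection whose range is closed under
  \<open>x * y + y * x\<close> but not under products. Closure of the range under products must
  therefore enter separately, and it does so in the derivation argument. The unitization is needed
  because order estimates such as \<open>norm_positive (t *\<^sub>R 1 - h)\<close> refer to a unit.
  The price is that a state restricted from it may have norm below one, or vanish. Functional
  calculus is replaced by two tools: square roots obtained by iteration, and the estimate
  \<open>norm (x ^ n * (1 - x)) \<le> 1 / Suc n\<close> for positive contractions.\<close>

lemma clinearI:
  fixes f :: "'a::complex_vector \<Rightarrow> 'b::complex_vector"
  assumes "\<And>x y. f (x + y) = f x + f y" "\<And>c x. f (c *\<^sub>C x) = c *\<^sub>C f x"
  shows "clinear f"
  by unfold_locales (use assms in auto)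

lemma clinearD:
  fixes f :: "'a::complex_vector \<Rightarrow> 'b::complex_vector"
  assumes "clinear f"
  shows "f (x + y) = f x + f y" "f (c *\<^sub>C x) = c *\<^sub>C f x" "f (x - y) = f x - f y"
    "f (- x) = - f x" "f 0 = 0" "f (r *\<^sub>R x) = r *\<^sub>R f x"
proof -
  interpret lin: Vector_Spaces.linear scaleC scaleC f by (rule assms)
  show "f (x + y) = f x + f y" "f (c *\<^sub>C x) = c *\<^sub>C f x" "f (x - y) = f x - f y"
    "f (- x) = - f x" "f 0 = 0"
    by (fact lin.add lin.scale lin.diff lin.neg lin.zero)+
  show "f (r *\<^sub>R x) = r *\<^sub>R f x" by (simp add: scaleR_scaleC lin.scale)
qed

lemma norm_star [simp]: "norm (star x) = norm (x::'a::cstar_algebra)"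
proof -
  have le: "norm y \<le> norm (star y)" for y :: 'a
  proof (cases "y = 0")
    case False
    have "norm y * norm y \<le> norm (star y) * norm y"
      using norm_mult_ineq[of "star y" y] cstar_identity[of y] by (simp add: power2_eq_square)
    then show ?thesis using False by simp
  qed simp
  show ?thesis using le[of x] le[of "star x"] by (simp add: star_star)
qed

lemma star_scaleR: "star (r *\<^sub>R x) = r *\<^sub>R star (x::'a::cstar_algebra)"
  by (simp add: scaleR_scaleC star_scaleC)

lemma star_zero [simp]: "star 0 = (0::'a::cstar_algebra)"
  using star_scaleR[of 0 "0::'a"] by simp

lemma star_minus: "star (- x) = - star (x::'a::cstar_algebra)"
  using star_scaleR[of "-1" x] by simp

lemma star_diff: "star (x - y) = star x - star (y::'a::cstar_algebra)"
  using star_add[of x "- y"] by (simp add: star_minus)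

lemma bounded_linear_star: "bounded_linear (star :: 'a \<Rightarrow> 'a::cstar_algebra)"
  by (rule bounded_linear_intro[where K = 1]) (simp_all add: star_add star_scaleR)

lemmas continuous_on_star [continuous_intros] =
  bounded_linear.continuous_on[OF bounded_linear_star]

lemma cstar_identity_selfadjoint: "star k = k \<Longrightarrow> norm (k * k) = (norm (k::'a::cstar_algebra))\<^sup>2"
  using cstar_identity[of k] by simp

lemma cstar_norm_zero: "star x * x = 0 \<Longrightarrow> x = (0::'a::cstar_algebra)"
  using cstar_identity[of x] by simp

lemma scaleC_scaleR_commute: "c *\<^sub>C (r *\<^sub>R x) = r *\<^sub>R (c *\<^sub>C (x::'a::complex_vector))"
  by (simp add: scaleR_scaleC scaleC_scaleC mult.commute)

lemmas scaleC_simps = scaleC_add_right scaleC_scaleC mult_scaleC_left mult_scaleC_right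
  scaleC_scaleR_commute
  complex_vector.scale_minus_right complex_vector.scale_minus_left
  complex_vector.scale_right_diff_distrib complex_vector.scale_zero_right scaleC_one

lemmas star_simps = star_star star_add star_diff star_minus star_scaleC star_scaleR star_mult

lemma cartesian_decomposition:
  fixes x :: "'a::cstar_algebra"
  obtains h k where "star h = h" "star k = k" "x = h + \<i> *\<^sub>C k" "norm h \<le> norm x" "norm k \<le> norm x"
proof
  let ?h = "(1/2) *\<^sub>R (x + star x)" and ?k = "(1/2) *\<^sub>R (\<i> *\<^sub>C (star x - x))"
  show "star ?h = ?h" by (simp add: star_simps add.commute)
  have "star (\<i> *\<^sub>C (star x - x)) = \<i> *\<^sub>C (star x - x)"
    by (simp add: star_simps complex_vector.scale_minus_left flip: complex_vector.scale_minus_right)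
  then show "star ?k = ?k" by (simp add: star_scaleR)
  have "\<i> *\<^sub>C ?k = (1/2) *\<^sub>R (x - star x)"
    by (simp add: scaleC_scaleR_commute scaleC_scaleC complex_vector.scale_minus_left scaleC_one
        scaleR_right_diff_distrib)
  then have "?h + \<i> *\<^sub>C ?k = (1/2) *\<^sub>R (x + star x) + (1/2) *\<^sub>R (x - star x)"
    by simp
  also have "\<dots> = x"
    using scaleR_half_double[of x]
    by (simp add: scaleR_right_diff_distrib scaleR_right_distrib del: scaleR_half_double)
  finally show "x = ?h + \<i> *\<^sub>C ?k" ..
  show "norm ?h \<le> norm x"
    using norm_triangle_ineq[of x "star x"] by simp
  show "norm ?k \<le> norm x"
    using norm_triangle_ineq4[of "star x" x] by (simp add: norm_scaleC)
qed

class unital_cstar_algebra = cstar_algebra + real_normed_algebra_1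

lemma star_one [simp]: "star 1 = (1::'a::unital_cstar_algebra)"
  by (metis mult.right_neutral mult.left_neutral star_mult star_star)

lemma star_power: "star (x ^ n) = star (x::'a::unital_cstar_algebra) ^ n"
  by (induction n) (simp_all add: star_mult power_commutes)

section \<open>Square roots and order estimates without the spectrum\<close>

text \<open>The equation for \<open>z\<close> is the fixed-point equation
  \<open>z = (y + z * z) / 2\<close>, solved by iteration from 0. The last clause transfers to
  \<open>z\<close> every property of \<open>y\<close> that survives real linear combinations,
  squares and limits. The iteration forms squares only, so the self-adjoint elements, which are not
  closed under products, qualify as \<open>S\<close>.\<close>

lemma sqrt_iteration:
  fixes y :: "'a::{real_normed_algebra_1,banach}"
  assumes y: "norm y \<le> 1"
  obtains z where "(1 - z) * (1 - z) = 1 - y" "norm z \<le> 1"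
    "\<And>S. subspace S \<Longrightarrow> closed S \<Longrightarrow> (\<And>x. x \<in> S \<Longrightarrow> x * x \<in> S) \<Longrightarrow> y \<in> S \<Longrightarrow> z \<in> S"
proof -
  define z where "z = rec_nat (0::'a) (\<lambda>_ w. (1/2) *\<^sub>R (y + w * w))"
  \<comment> \<open>The same iteration for the number 1. It dominates the norms of the iterates and
    of their increments, and it increases within [0, 1], so \<open>z\<close> is Cauchy.\<close>
  define \<zeta> where "\<zeta> = rec_nat (0::real) (\<lambda>_ w. (1 + w * w) / 2)"
  have z: "z 0 = 0" "z (Suc n) = (1/2) *\<^sub>R (y + z n * z n)" for n by (simp_all add: z_def)
  have \<zeta>: "\<zeta> 0 = 0" "\<zeta> (Suc n) = (1 + \<zeta> n * \<zeta> n) / 2" for n by (simp_all add: \<zeta>_def)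
  have \<zeta>01: "0 \<le> \<zeta> n \<and> \<zeta> n \<le> 1" for n
    by (induction n) (auto simp: \<zeta> mult_le_one)
  have zle: "norm (z n) \<le> \<zeta> n" for n
  proof (induction n)
    case (Suc n)
    have "norm (z n * z n) \<le> \<zeta> n * \<zeta> n"
      by (rule order.trans[OF norm_mult_ineq]) (use Suc \<zeta>01 in \<open>auto intro: mult_mono\<close>)
    then show ?case using norm_triangle_ineq[of y "z n * z n"] y by (simp add: z \<zeta>)
  qed (simp add: z \<zeta>)
  have comm: "z n * y = y * z n" for n
    by (induction n) (simp_all add: z algebra_simps, metis mult.assoc)
  have commz: "z n * z m = z m * z n" for n m
  proof (induction n)
    case (Suc n)
    then have "z n * z n * z m = z m * (z n * z n)" by (metis mult.assoc)
    then show ?case by (simp add: z comm algebra_simps)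
  qed (simp add: z)
  have step: "norm (z (Suc n) - z n) \<le> \<zeta> (Suc n) - \<zeta> n" for n
  proof (induction n)
    case (Suc n)
    \<comment> \<open>The iterates are polynomials in \<open>y\<close> and commute, so the
      difference of two squares factors.\<close>
    have "z (Suc (Suc n)) - z (Suc n) = (1/2) *\<^sub>R ((z (Suc n) - z n) * (z (Suc n) + z n))"
      unfolding z(2)[of "Suc n"] using z(2)[of n] commz[of "Suc n" n]
      by (simp add: algebra_simps)
    also have "norm \<dots> \<le> (1/2) * (norm (z (Suc n) - z n) * norm (z (Suc n) + z n))"
      using norm_mult_ineq by simp
    also have "\<dots> \<le> (1/2) * ((\<zeta> (Suc n) - \<zeta> n) * (\<zeta> (Suc n) + \<zeta> n))"
      using norm_triangle_ineq[of "z (Suc n)" "z n"] zle[of n] zle[of "Suc n"] \<zeta>01[of n] \<zeta>01[of "Suc n"]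
        order_trans[OF norm_ge_zero Suc]
      by (intro mult_left_mono mult_mono Suc) auto
    also have "\<dots> = \<zeta> (Suc (Suc n)) - \<zeta> (Suc n)"
      unfolding \<zeta>(2)[of "Suc n"] using \<zeta>(2)[of n] by (simp add: field_simps)
    finally show ?case .
  qed (use y in \<open>simp add: z \<zeta>\<close>)
  have inc: "\<zeta> n \<le> \<zeta> (Suc n)" for n
    using step[of n] norm_ge_zero order_trans by (metis diff_ge_0_iff_ge)
  have bnd: "norm (z (m + k) - z m) \<le> \<zeta> (m + k) - \<zeta> m" for m k
  proof (induction k)
    case (Suc k)
    then show ?case
      using step[of "m + k"] norm_triangle_ineq[of "z (Suc (m + k)) - z (m + k)" "z (m + k) - z m"]
      by simp
  qed simp
  have "convergent \<zeta>"
    by (rule Bseq_monoseq_convergent)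
      (use \<zeta>01 inc in \<open>auto simp: monoseq_Suc intro!: BseqI'[of _ 1]\<close>)
  then have "Cauchy \<zeta>" by (rule convergent_Cauchy)
  have "Cauchy z"
  proof (rule CauchyI')
    fix e :: real assume "e > 0"
    then obtain M where M: "\<And>m n. m \<ge> M \<Longrightarrow> n \<ge> M \<Longrightarrow> norm (\<zeta> m - \<zeta> n) < e"
      using CauchyD[OF \<open>Cauchy \<zeta>\<close>] by blast
    have "norm (z m - z n) < e" if "m \<ge> M" "n > m" for m n
    proof -
      obtain k where k: "n = m + k" using \<open>n > m\<close> less_imp_add_positive by blast
      show ?thesis using bnd[of m k] M[of n m] that unfolding k by (simp add: norm_minus_commute)
    qed
    then show "\<exists>M. \<forall>m\<ge>M. \<forall>n>m. dist (z m) (z n) < e" by (auto simp: dist_norm)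
  qed
  then obtain L where L: "z \<longlonglongrightarrow> L" using Cauchy_convergent convergentD by blast
  have "(\<lambda>n. (1/2) *\<^sub>R (y + z n * z n)) \<longlonglongrightarrow> (1/2) *\<^sub>R (y + L * L)"
    by (intro tendsto_intros L)
  then have "L = (1/2) *\<^sub>R (y + L * L)"
    by (rule LIMSEQ_unique[OF LIMSEQ_Suc[OF L], unfolded z])
  then have "2 *\<^sub>R L = 2 *\<^sub>R ((1/2) *\<^sub>R (y + L * L))" by (rule arg_cong)
  then have "L + L = y + L * L" by (simp add: scaleR_2)
  then have "(1 - L) * (1 - L) = 1 - y" by (simp add: algebra_simps)
  moreover have "L \<in> S" if "subspace S" "closed S" "\<And>x. x \<in> S \<Longrightarrow> x * x \<in> S" "y \<in> S" for S
  proof -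
    have "z n \<in> S" for n
      by (induction n) (simp_all add: z that subspace_0 subspace_scale subspace_add)
    then show ?thesis using closed_sequentially[OF \<open>closed S\<close> _ L] by blast
  qed
  moreover have "norm L \<le> 1"
    by (rule LIMSEQ_le_const2[OF tendsto_norm[OF L]]) (use zle \<zeta>01 order_trans in blast)
  ultimately show thesis using that by blast
qed

text \<open>The elements \<open>H\<^sup>* H\<close> are characterized by self-adjointness and \<open>\<parallel>s - a\<parallel> \<le> s\<close> for some \<open>s\<close>; this
  avoids the spectrum.\<close>

definition norm_positive :: "'a::unital_cstar_algebra \<Rightarrow> bool" where
  "norm_positive a \<longleftrightarrow> star a = a \<and> (\<exists>s\<ge>0. norm (s *\<^sub>R 1 - a) \<le> s)"

lemma norm_positive_star: "norm_positive a \<Longrightarrow> star a = a"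
  by (simp add: norm_positive_def)

lemma subspace_selfadjoint: "subspace {x::'a::cstar_algebra. star x = x}"
  by (auto simp: subspace_def star_add star_scaleR)

lemma closed_selfadjoint: "closed {x::'a::cstar_algebra. star x = x}"
  by (intro closed_Collect_eq continuous_intros)

lemma subspace_commutant: "subspace {x::'a::real_algebra. x * b = b * x}"
  by (auto simp: subspace_def algebra_simps)

lemma closed_commutant: "closed {x::'a::real_normed_algebra. x * b = b * x}"
  by (intro closed_Collect_eq continuous_intros)

lemma commutant_mult: "x * b = b * x \<Longrightarrow> y * b = b * y \<Longrightarrow> (x * y) * b = b * (x * y :: 'a::semigroup_mult)"
  by (metis mult.assoc)

text \<open>Division by \<open>s\<close> brings \<open>a\<close> to the form \<open>1 - y\<close>
  with \<open>norm y \<le> 1\<close>. The clause on \<open>S\<close> is exported because a root must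
  later be shown to lie in the range of a projection.\<close>

lemma norm_positive_sqrt:
  fixes a :: "'a::unital_cstar_algebra"
  assumes "norm_positive a"
  obtains k where "norm_positive k" "star k = k" "k * k = a"
    "\<And>S. subspace S \<Longrightarrow> closed S \<Longrightarrow> (\<And>x. x \<in> S \<Longrightarrow> x * x \<in> S) \<Longrightarrow> 1 \<in> S \<Longrightarrow> a \<in> S \<Longrightarrow> k \<in> S"
    "\<And>b. a * b = b * a \<Longrightarrow> k * b = b * k"
proof -
  obtain s where s: "s \<ge> 0" "norm (s *\<^sub>R 1 - a) \<le> s" and sa: "star a = a"
    using assms by (auto simp: norm_positive_def)
  have *: "\<exists>k. k * k = a \<and> (\<exists>s\<ge>0. norm (s *\<^sub>R 1 - k) \<le> s) \<and> (\<forall>S. subspace S \<longrightarrow> closed S \<longrightarrow> (\<forall>x. x \<in> S \<longrightarrow> x * x \<in> S) \<longrightarrow> 1 \<in> S \<longrightarrow> a \<in> S \<longrightarrow> k \<in> S)"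
  proof (cases "s = 0")
    case True
    then have "a = 0" using s by simp
    then show ?thesis by (intro exI[of _ 0] conjI) (auto simp: subspace_0 intro!: exI[of _ 0])
  next
    case False
    define y where "y = 1 - (1/s) *\<^sub>R a"
    have "y = (1/s) *\<^sub>R (s *\<^sub>R 1 - a)" using False by (simp add: y_def algebra_simps)
    then have "norm y \<le> 1" using s False by (simp add: divide_simps)
    then obtain z where z: "(1 - z) * (1 - z) = 1 - y" "norm z \<le> 1"
      "\<And>S. subspace S \<Longrightarrow> closed S \<Longrightarrow> (\<And>x. x \<in> S \<Longrightarrow> x * x \<in> S) \<Longrightarrow> y \<in> S \<Longrightarrow> z \<in> S"
      using sqrt_iteration by metis
    show ?thesis
    proof (intro exI[of _ "sqrt s *\<^sub>R (1 - z)"] conjI allI impI)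
      show "sqrt s *\<^sub>R (1 - z) * sqrt s *\<^sub>R (1 - z) = a"
        using z(1) s(1) False by (simp add: y_def)
      have "sqrt s *\<^sub>R 1 - sqrt s *\<^sub>R (1 - z) = sqrt s *\<^sub>R z" by (simp add: algebra_simps)
      then show "\<exists>s'\<ge>0. norm (s' *\<^sub>R 1 - sqrt s *\<^sub>R (1 - z)) \<le> s'"
        using s(1) z(2) by (intro exI[of _ "sqrt s"]) (simp add: mult_left_le)
      fix S :: "'a set"
      assume S: "subspace S" "closed S" "\<forall>x. x \<in> S \<longrightarrow> x * x \<in> S" "1 \<in> S" "a \<in> S"
      then have "y \<in> S" unfolding y_def by (intro subspace_diff subspace_scale)
      then show "sqrt s *\<^sub>R (1 - z) \<in> S"
        using S z(3)[of S] by (intro subspace_diff subspace_scale) auto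
    qed
  qed
  then obtain k where k: "k * k = a" "\<exists>s\<ge>0. norm (s *\<^sub>R 1 - k) \<le> s"
      "\<And>S. subspace S \<Longrightarrow> closed S \<Longrightarrow> (\<And>x. x \<in> S \<Longrightarrow> x * x \<in> S) \<Longrightarrow> 1 \<in> S \<Longrightarrow> a \<in> S \<Longrightarrow> k \<in> S"
    by blast
  have "star k = k"
    using k(3)[OF subspace_selfadjoint closed_selfadjoint] by (simp add: star_mult sa)
  moreover from this have "norm_positive k" using k(2) by (simp add: norm_positive_def)
  moreover have "k * b = b * k" if "a * b = b * a" for b
    using k(3)[OF subspace_commutant closed_commutant, of b] commutant_mult that by auto
  ultimately show thesis using k that by blast
qed

text \<open>The element \<open>w = k + \<i> *\<^sub>C l\<close> is normal with
  \<open>star w * w = k * k + l * l\<close>, so the C*-identity gives its norm, and \<open>k\<close>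
  is its real part.\<close>

lemma norm_le_of_commuting_squares:
  fixes k :: "'a::unital_cstar_algebra"
  assumes "star k = k" "star l = l" "k * l = l * k" "k * k + l * l = t *\<^sub>R 1"
  shows "(norm k)\<^sup>2 \<le> \<bar>t\<bar>"
proof -
  define w where "w = k + \<i> *\<^sub>C l"
  have sw: "star w = k - \<i> *\<^sub>C l" by (simp add: w_def star_simps assms scaleC_simps)
  have "star w * w = k * k + l * l"
    unfolding sw unfolding w_def by (simp add: algebra_simps scaleC_simps assms(3))
  then have "(norm w)\<^sup>2 = \<bar>t\<bar>" using cstar_identity[of w] assms by simp
  moreover have "k = (1/2) *\<^sub>R (w + star w)"
    unfolding sw unfolding w_def by (simp flip: scaleR_add_left)
  then have "norm k \<le> norm w"
    using norm_triangle_ineq[of w "star w"] by simp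
  ultimately show ?thesis by (metis norm_ge_zero power_mono)
qed

text \<open>Stands in for the fact that the spectrum of \<open>k * k\<close> lies in [0, 1]: a root
  \<open>l\<close> of \<open>1 - k * k\<close> commutes with \<open>k\<close>, and the two squares
  add up to 1.\<close>

lemma norm_one_minus_square_le:
  fixes k :: "'a::unital_cstar_algebra"
  assumes "star k = k" "norm k \<le> 1"
  shows "norm (1 - k * k) \<le> 1"
proof -
  have "norm (k * k) \<le> 1"
    using cstar_identity_selfadjoint[OF assms(1)] assms(2) by (simp add: power_le_one)
  then have "norm_positive (1 - k * k)"
    unfolding norm_positive_def by (intro conjI exI[of _ 1]) (simp_all add: star_simps assms)
  then obtain l where l: "star l = l" "l * l = 1 - k * k" "\<And>b. (1 - k * k) * b = b * (1 - k * k) \<Longrightarrow> l * b = b * l"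
    using norm_positive_sqrt by metis
  have "l * k = k * l" by (rule l(3)) (simp add: algebra_simps)
  then have "(norm l)\<^sup>2 \<le> 1"
    using norm_le_of_commuting_squares[of l k 1] l(1,2) assms by simp
  then show ?thesis using l(1,2) cstar_identity_selfadjoint[OF l(1)] by simp
qed

lemma norm_positive_square:
  fixes k :: "'a::unital_cstar_algebra"
  assumes "star k = k"
  shows "norm_positive (k * k)"
proof (cases "k = 0")
  case False
  define s where "s = (norm k)\<^sup>2"
  have "s > 0" using False by (simp add: s_def)
  define k' where "k' = (1 / norm k) *\<^sub>R k"
  have "norm (1 - k' * k') \<le> 1"
    using False by (intro norm_one_minus_square_le) (simp_all add: k'_def star_simps assms)
  moreover have "s *\<^sub>R 1 - k * k = s *\<^sub>R (1 - k' * k')"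
    using False by (simp add: s_def k'_def algebra_simps power2_eq_square)
  ultimately have "norm (s *\<^sub>R 1 - k * k) \<le> s"
    using \<open>s > 0\<close> by simp
  then show ?thesis
    using \<open>s > 0\<close> assms unfolding norm_positive_def by (intro conjI exI[of _ s]) (auto simp: star_mult)
qed (auto simp: norm_positive_def intro!: exI[of _ 0])

lemma norm_positive_add:
  assumes "norm_positive a" "norm_positive b"
  shows "norm_positive (a + b)"
proof -
  obtain s r where "s \<ge> 0" "norm (s *\<^sub>R 1 - a) \<le> s" "r \<ge> 0" "norm (r *\<^sub>R 1 - b) \<le> r"
    using assms by (auto simp: norm_positive_def)
  then have "norm ((s + r) *\<^sub>R 1 - (a + b)) \<le> s + r"
    using norm_triangle_ineq[of "s *\<^sub>R 1 - a" "r *\<^sub>R 1 - b"] by (simp add: algebra_simps)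
  then show ?thesis using assms \<open>s \<ge> 0\<close> \<open>r \<ge> 0\<close> unfolding norm_positive_def
    by (intro conjI exI[of _ "s + r"]) (auto simp: star_add)
qed

lemma norm_positive_scaleR:
  assumes "norm_positive a" "r \<ge> 0"
  shows "norm_positive (r *\<^sub>R a)"
proof -
  obtain s where "s \<ge> 0" "norm (s *\<^sub>R 1 - a) \<le> s"
    using assms by (auto simp: norm_positive_def)
  moreover have "(r * s) *\<^sub>R 1 - r *\<^sub>R a = r *\<^sub>R (s *\<^sub>R 1 - a)" by (simp add: algebra_simps)
  ultimately show ?thesis using assms unfolding norm_positive_def
    by (intro conjI exI[of _ "r * s"]) (auto simp: star_scaleR mult_left_mono)
qed

lemma norm_positive_scaleR_one: "t \<ge> 0 \<Longrightarrow> norm_positive (t *\<^sub>R 1)"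
  by (auto simp: norm_positive_def star_scaleR intro!: exI[of _ t])

lemma norm_positive_norm_minus:
  assumes "star h = h" "norm h \<le> t"
  shows "norm_positive (t *\<^sub>R 1 - h)"
proof -
  have "0 \<le> t" using assms(2) norm_ge_zero order_trans by blast
  then show ?thesis
    unfolding norm_positive_def by (intro conjI exI[of _ t]) (simp_all add: star_simps assms)
qed

lemma norm_positive_norm_plus:
  assumes "star h = h" "norm h \<le> t"
  shows "norm_positive (t *\<^sub>R 1 + h)"
  using norm_positive_norm_minus[of "- h" t] assms by (simp add: star_minus)

lemma norm_positive_mult:
  assumes "norm_positive a" "norm_positive b" "a * b = b * a"
  shows "norm_positive (a * b)"
proof -
  obtain k where k: "star k = k" "k * k = a" "\<And>b. a * b = b * a \<Longrightarrow> k * b = b * k"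
    using norm_positive_sqrt[OF assms(1)] by metis
  obtain l where l: "star l = l" "l * l = b" "\<And>c. b * c = c * b \<Longrightarrow> l * c = c * l"
    using norm_positive_sqrt[OF assms(2)] by metis
  have kl: "l * k = k * l" using l(3)[of k] k(3)[OF assms(3)] by simp
  have "a * b = (k * l) * (k * l)"
    by (metis k(2) l(2) kl mult.assoc)
  then show ?thesis using norm_positive_square[of "k * l"] by (simp add: star_mult k(1,2) l(1,2) kl)
qed

text \<open>The roots of \<open>a\<close> and of \<open>t *\<^sub>R 1 - a\<close> commute, and their
  squares add up to \<open>t *\<^sub>R 1\<close>.\<close>

lemma norm_positive_norm_le:
  assumes "norm_positive a" "norm_positive (t *\<^sub>R 1 - a)" "t \<ge> 0"
  shows "norm a \<le> t"
proof -
  obtain k where k: "star k = k" "k * k = a" "\<And>b. a * b = b * a \<Longrightarrow> k * b = b * k"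
    using norm_positive_sqrt[OF assms(1)] by metis
  obtain l where l: "star l = l" "l * l = t *\<^sub>R 1 - a"
    "\<And>c. (t *\<^sub>R 1 - a) * c = c * (t *\<^sub>R 1 - a) \<Longrightarrow> l * c = c * l"
    using norm_positive_sqrt[OF assms(2)] by metis
  have "l * k = k * l" using l(3)[of k] k(3)[of a] by (simp add: algebra_simps)
  then have "(norm k)\<^sup>2 \<le> t"
    using norm_le_of_commuting_squares[of k l t] assms(3) k(1,2) l(1,2) by simp
  then show ?thesis using cstar_identity_selfadjoint[OF k(1)] k(2) by simp
qed

lemma norm_positive_antisym:
  assumes "norm_positive a" "norm_positive (- a)"
  shows "a = 0"
  using norm_positive_norm_le[of a 0] assms by simp

lemma norm_positive_power:
  assumes "norm_positive a"
  shows "norm_positive (a ^ n)"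
proof (induction n)
  case 0
  then show ?case using norm_positive_scaleR_one[of 1] by simp
next
  case (Suc n)
  then show ?case using norm_positive_mult[OF assms, of "a ^ n"] by (simp add: power_commutes)
qed

text \<open>For numbers in [0, 1], each of the \<open>n + 1\<close> terms of the sum
  \<open>1 + x + ... + x ^ n\<close> is at least \<open>x ^ n\<close>; multiplied by
  \<open>1 - x\<close> this reads \<open>(n + 1) * x ^ n * (1 - x) \<le> 1 - x ^ (n + 1)\<close>.
  The proof of \<open>main\<close> is the operator form of it.\<close>

lemma power_mult_one_minus_le:
  fixes x :: "'a::unital_cstar_algebra"
  assumes x: "norm_positive x" "norm x \<le> 1"
  shows "norm (x ^ n * (1 - x)) \<le> 1 / (Suc n)"
proof -
  have y: "norm_positive (1 - x)"
    using norm_positive_norm_minus[of x 1] assms by (simp add: norm_positive_star)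
  have xn: "norm (x ^ n) \<le> 1" for n
    using norm_power_ineq[of x n] x(2) power_le_one[of "norm x" n] by simp
  have yn: "norm_positive (1 - x ^ n)" for n
    using norm_positive_norm_minus[of "x ^ n" 1] xn[of n] norm_positive_power[OF x(1), of n]
    by (simp add: norm_positive_star)
  have comm: "x ^ n * x = x * x ^ n" for n by (simp add: power_commutes)
  have main: "norm_positive (1 - x ^ Suc n - real (Suc n) *\<^sub>R (x ^ n * (1 - x)))" for n
  proof (induction n)
    case 0
    then show ?case using norm_positive_scaleR_one[of 0] by (simp add: algebra_simps)
  next
    case (Suc n)
    let ?S = "1 - x ^ Suc n - real (Suc n) *\<^sub>R (x ^ n * (1 - x))"
    \<comment> \<open>Both summands are products of commuting positive elements, which keeps the
      induction inside the cone.\<close>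
    have "1 - x ^ Suc (Suc n) - real (Suc (Suc n)) *\<^sub>R (x ^ Suc n * (1 - x))
       = x * ?S + (1 - x) * (1 - x ^ Suc n)"
      by (simp add: algebra_simps comm scaleR_2)
    moreover have "norm_positive (x * ?S)"
      by (intro norm_positive_mult x Suc) (simp add: algebra_simps comm)
    moreover have "norm_positive ((1 - x) * (1 - x ^ Suc n))"
      by (intro norm_positive_mult y yn) (simp add: algebra_simps comm)
    ultimately show ?case using norm_positive_add by simp
  qed
  have "norm_positive (x ^ n * (1 - x))"
    by (intro norm_positive_mult y norm_positive_power x) (simp add: algebra_simps comm)
  then have "norm_positive (real (Suc n) *\<^sub>R (x ^ n * (1 - x)))"
    by (rule norm_positive_scaleR) simp
  moreover have "norm_positive (1 *\<^sub>R 1 - real (Suc n) *\<^sub>R (x ^ n * (1 - x)))"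
    using norm_positive_add[OF main[of n] norm_positive_power[OF x(1), of "Suc n"]]
    by (simp add: algebra_simps)
  ultimately have "norm (real (Suc n) *\<^sub>R (x ^ n * (1 - x))) \<le> 1"
    by (rule norm_positive_norm_le) simp
  then have "real (Suc n) * norm (x ^ n * (1 - x)) \<le> 1" by (simp only: norm_scaleR abs_of_nat)
  then show ?thesis by (simp only: pos_le_divide_eq of_nat_0_less_iff zero_less_Suc mult.commute)
qed

lemma norm_power_selfadjoint:
  fixes x :: "'a::unital_cstar_algebra"
  assumes "star x = x"
  shows "norm (x ^ (2 ^ k)) = norm x ^ (2 ^ k)"
proof (induction k)
  case (Suc k)
  have "x ^ (2 ^ Suc k) = x ^ (2 ^ k) * x ^ (2 ^ k)"
    by (simp add: mult_2 flip: power_add)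
  then have "norm (x ^ (2 ^ Suc k)) = (norm (x ^ (2 ^ k)))\<^sup>2"
    using cstar_identity_selfadjoint[of "x ^ (2 ^ k)"] assms by (simp add: star_power)
  then show ?case using Suc by (simp add: mult.commute flip: power_mult)
qed simp

section \<open>Positivity of \<open>star H * H\<close>\<close>

lemma norm_positive_plus_right_inverse:
  fixes q :: "'a::unital_cstar_algebra"
  assumes "norm_positive q" "t > 0"
  obtains c where "(q + t *\<^sub>R 1) * c = 1"
proof -
  obtain s where s: "s \<ge> 0" "norm (s *\<^sub>R 1 - q) \<le> s"
    using assms by (auto simp: norm_positive_def)
  define r where "r = s + t"
  have r: "r > 0" "s < r" using s assms by (auto simp: r_def)
  define y where "y = (1/r) *\<^sub>R (s *\<^sub>R 1 - q)"
  have "norm y < 1" using s r by (simp add: y_def divide_simps)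
  then have S: "summable (\<lambda>n. y ^ n)" by (rule complete_algebra_summable_geometric)
  have "y * (\<Sum>n. y ^ n) = (\<Sum>n. y ^ Suc n)"
    using suminf_mult[OF S, of y] by simp
  then have "(1 - y) * (\<Sum>n. y ^ n) = 1"
    using suminf_split_head[OF S] by (simp add: algebra_simps)
  moreover have "q + t *\<^sub>R 1 = r *\<^sub>R (1 - y)"
    using r by (simp add: y_def algebra_simps) (simp add: r_def algebra_simps)
  ultimately have "(q + t *\<^sub>R 1) * ((1/r) *\<^sub>R (\<Sum>n. y ^ n)) = 1"
    using r by simp
  then show thesis using that by blast
qed

lemma star_mult_self_plus_swap:
  fixes y :: "'a::unital_cstar_algebra"
  shows "norm_positive (star y * y + y * star y)"
proof -
  obtain h k where h: "star h = h" "star k = k" "y = h + \<i> *\<^sub>C k"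
    using cartesian_decomposition[of y] by metis
  have "star y * y + y * star y = 2 *\<^sub>R (h * h + k * k)"
    unfolding h(3) by (simp add: star_simps h algebra_simps scaleC_simps scaleR_2)
  then show ?thesis
    by (simp add: norm_positive_scaleR norm_positive_add norm_positive_square h)
qed

text \<open>Replaces the argument that \<open>star y * y\<close> and \<open>y * star y\<close> have
  the same nonzero spectrum. Since \<open>star y * y\<close> is negative, \<open>y * star y\<close>
  is positive, so adding \<open>t > 0\<close> to it gives an invertible element. Invertibility is
  carried over to \<open>t *\<^sub>R 1 - m * m\<close>, although \<open>t\<close> is the norm of
  \<open>m * m\<close>.\<close>

lemma star_mult_self_negative:
  fixes y :: "'a::unital_cstar_algebra"
  assumes "star m = m" "star y * y = - (m * m)"
  shows "m = 0"
proof (rule ccontr)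
  assume "m \<noteq> 0"
  define t where "t = (norm m)\<^sup>2"
  have t: "t > 0" using \<open>m \<noteq> 0\<close> by (simp add: t_def)
  define q where "q = y * star y"
  have "norm_positive q"
    using norm_positive_add[OF star_mult_self_plus_swap[of y] norm_positive_square[OF assms(1)]]
    by (simp add: assms q_def)
  then obtain c where c: "(q + t *\<^sub>R 1) * c = 1"
    using norm_positive_plus_right_inverse t by blast
  \<comment> \<open>Up to the factor \<open>t\<close> this is the inverse of
    \<open>t *\<^sub>R 1 + star y * y\<close>, by the usual formula that expresses the resolvent of
    \<open>star y * y\<close> through the resolvent \<open>c\<close> of
    \<open>y * star y\<close>.\<close>
  define d where "d = 1 - star y * c * y"
  have "(t *\<^sub>R 1 + star y * y) * d = t *\<^sub>R 1 + star y * y - star y * ((q + t *\<^sub>R 1) * c) * y"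
    by (simp add: d_def q_def algebra_simps)
  then have d: "(t *\<^sub>R 1 - m * m) * d = t *\<^sub>R 1"
    by (simp add: c assms)
  define x where "x = (1/t) *\<^sub>R (m * m)"
  have x: "norm_positive x" "norm x = 1"
    using t norm_positive_scaleR[OF norm_positive_square[OF assms(1)], of "1/t"] assms(1)
    by (simp_all add: x_def cstar_identity_selfadjoint t_def)
  have "1 - x = (1/t) *\<^sub>R (t *\<^sub>R 1 - m * m)" using t by (simp add: x_def algebra_simps)
  then have dx: "(1 - x) * d = 1" using d t by simp
  \<comment> \<open>A right inverse of \<open>1 - x\<close> forces the powers of \<open>x\<close> to
    decay, whereas the C*-identity keeps the powers with exponent \<open>2 ^ k\<close> at norm
    1.\<close>
  have bound: "norm (x ^ n) \<le> norm d / Suc n" for n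
  proof -
    have "norm (x ^ n) = norm (x ^ n * (1 - x) * d)" by (simp add: mult.assoc dx)
    also have "\<dots> \<le> norm (x ^ n * (1 - x)) * norm d" by (rule norm_mult_ineq)
    also have "\<dots> \<le> 1 / Suc n * norm d"
      by (intro mult_right_mono power_mult_one_minus_le) (use x in auto)
    finally show ?thesis by simp
  qed
  obtain k :: nat where k: "norm d < real k" using reals_Archimedean2 by blast
  have "real k < 2 ^ k" by (rule of_nat_less_two_power)
  have "norm d < Suc (2 ^ k)" using order.strict_trans[OF k \<open>real k < 2 ^ k\<close>] by simp
  then have "norm d / Suc (2 ^ k) < 1"
    by (simp only: pos_divide_less_eq of_nat_0_less_iff zero_less_Suc mult_1)
  then show False
    using bound[of "2 ^ k"] norm_power_selfadjoint[OF norm_positive_star[OF x(1)], of k] x(2) by simp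
qed

text \<open>With \<open>r\<close> the absolute value of \<open>h = star H * H\<close>, the element
  \<open>n = r - h\<close> is twice the negative part of \<open>h\<close>. Then
  \<open>star (H * n) * (H * n)\<close> is minus the square of \<open>k * n\<close>, where
  \<open>k\<close> is a root of \<open>r\<close>, so the previous lemma kills \<open>k * n\<close>
  and finally \<open>n\<close>.\<close>

lemma norm_positive_star_mult_self:
  fixes H :: "'a::unital_cstar_algebra"
  shows "norm_positive (star H * H)"
proof -
  define h where "h = star H * H"
  have h: "star h = h" by (simp add: h_def star_mult star_star)
  obtain r where r: "norm_positive r" "star r = r" "r * r = h * h"
      "\<And>b. (h * h) * b = b * (h * h) \<Longrightarrow> r * b = b * r"
    using norm_positive_sqrt[OF norm_positive_square[OF h]] by metis
  have rh: "r * h = h * r" by (rule r(4)) (simp add: mult.assoc)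
  define n where "n = r - h"
  have n: "star n = n" by (simp add: n_def star_diff h r(2))
  have rn: "r * n = n * r" by (simp add: n_def algebra_simps rh)
  have hn: "h * n = - (r * n)" by (simp add: n_def algebra_simps rh r(3))
  obtain k where k: "star k = k" "k * k = r" "\<And>b. r * b = b * r \<Longrightarrow> k * b = b * k"
    using norm_positive_sqrt[OF r(1)] by metis
  have kn: "k * n = n * k" by (rule k(3)[OF rn])
  have "star (H * n) * (H * n) = n * (h * n)" by (simp add: star_mult n h_def mult.assoc)
  also have "\<dots> = - (n * (k * k) * n)" by (simp add: hn k(2) mult.assoc)
  also have "\<dots> = - ((k * n) * (k * n))" by (simp add: mult.assoc kn)
  finally have "k * n = 0"
    by (intro star_mult_self_negative[of "k * n" "H * n"]) (simp_all add: star_mult n k(1) kn)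
  then have "r * n = 0" by (simp add: mult.assoc flip: k(2))
  then have "star n * n = 0" using hn by (simp add: n) (simp add: n_def left_diff_distrib)
  then have "n = 0" by (rule cstar_norm_zero)
  then show ?thesis using r(1) by (simp add: n_def h_def)
qed

section \<open>Unital positive projections\<close>

lemma norm_positive_conjugate:
  fixes x :: "'a::unital_cstar_algebra"
  assumes "norm_positive a"
  shows "norm_positive (star x * a * x)"
proof -
  obtain k where k: "star k = k" "k * k = a" using norm_positive_sqrt[OF assms] by metis
  then have "star x * a * x = star (k * x) * (k * x)" by (simp add: star_mult mult.assoc flip: k(2))
  then show ?thesis using norm_positive_star_mult_self by metis
qed

text \<open>The cone is closed. The radius \<open>s\<close> in the definition may differ for each
  approximant \<open>b\<close>, so it is first replaced by a common one near \<open>norm a\<close>,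
  which is admissible because it bounds \<open>norm b\<close>.\<close>

lemma norm_positive_approx:
  fixes a :: "'a::unital_cstar_algebra"
  assumes "\<And>e. e > 0 \<Longrightarrow> \<exists>b. norm_positive b \<and> norm (a - b) \<le> e"
  shows "norm_positive a"
proof -
  have sa: "norm (star a - a) \<le> 0"
  proof (rule field_le_epsilon)
    fix e :: real assume "e > 0"
    then obtain b where b: "norm_positive b" "norm (a - b) \<le> e/2" using assms[of "e/2"] by auto
    have "star a - a = star (a - b) - (a - b)" using b(1) by (simp add: star_diff norm_positive_star)
    then have "norm (star a - a) \<le> norm (star (a - b)) + norm (a - b)"
      using norm_triangle_ineq4[of "star (a - b)" "a - b"] by (simp only:)
    then show "norm (star a - a) \<le> 0 + e" using b(2) by simp
  qed
  have "norm (norm a *\<^sub>R 1 - a) \<le> norm a"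
  proof (rule field_le_epsilon)
    fix e :: real assume "e > 0"
    then obtain b where b: "norm_positive b" "norm (a - b) \<le> e/3" using assms[of "e/3"] by auto
    let ?t = "norm a + e/3"
    have t: "norm b \<le> ?t" "0 \<le> ?t"
      using norm_triangle_ineq4[of a "a - b"] b(2) \<open>e > 0\<close> by simp_all
    have "norm (?t *\<^sub>R 1 - b) \<le> ?t"
      using norm_positive_norm_le[OF norm_positive_norm_minus[OF norm_positive_star[OF b(1)] t(1)] _ t(2)]
        b(1) by simp
    moreover have "norm a *\<^sub>R 1 - a = (?t *\<^sub>R 1 - b) - ((e/3) *\<^sub>R 1 + (a - b))"
      by (simp add: algebra_simps)
    then have "norm (norm a *\<^sub>R 1 - a) \<le> norm (?t *\<^sub>R 1 - b) + norm ((e/3) *\<^sub>R 1 + (a - b))"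
      by (simp only: norm_triangle_ineq4)
    moreover have "norm ((e/3) *\<^sub>R 1 + (a - b)) \<le> e/3 + e/3"
      using norm_triangle_ineq[of "(e/3) *\<^sub>R 1" "a - b"] b(2) \<open>e > 0\<close> by simp
    ultimately show "norm (norm a *\<^sub>R 1 - a) \<le> norm a + e" by simp
  qed
  then show ?thesis using sa unfolding norm_positive_def by (intro conjI exI[of _ "norm a"]) auto
qed

lemma cartesian_unique:
  fixes h :: "'a::cstar_algebra"
  assumes "h + \<i> *\<^sub>C k = h' + \<i> *\<^sub>C k'" "star h = h" "star k = k" "star h' = h'" "star k' = k'"
  shows "h = h'" "k = k'"
proof -
  have "star (h + \<i> *\<^sub>C k) = star (h' + \<i> *\<^sub>C k')" using assms(1) by simp
  then have "h - \<i> *\<^sub>C k = h' - \<i> *\<^sub>C k'"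
    by (simp add: star_add star_scaleC assms(2-5) complex_vector.scale_minus_left)
  then have "(h + \<i> *\<^sub>C k) + (h - \<i> *\<^sub>C k) = (h' + \<i> *\<^sub>C k') + (h' - \<i> *\<^sub>C k')"
    using assms(1) by simp
  then have "2 *\<^sub>R h = 2 *\<^sub>R h'" by (simp add: scaleR_2)
  then show "h = h'" by simp
  then show "k = k'" using assms(1) by simp
qed

text \<open>By idempotence the fixed points are exactly the range, so \<open>fixed_mult\<close> says
  that the range is closed under products.\<close>

locale unital_positive_projection =
  fixes E :: "'a::unital_cstar_algebra \<Rightarrow> 'a"
  assumes clinear: "clinear E"
    and idem: "E (E x) = E x"
    and one [simp]: "E 1 = 1"
    and pos: "norm_positive a \<Longrightarrow> norm_positive (E a)"
    and fixed_mult: "E x = x \<Longrightarrow> E y = y \<Longrightarrow> E (x * y) = x * y"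
begin

lemma add: "E (x + y) = E x + E y"
  and scaleC: "E (c *\<^sub>C x) = c *\<^sub>C E x"
  and diff: "E (x - y) = E x - E y"
  and minus: "E (- x) = - E x"
  and zero: "E 0 = 0"
  by (fact clinearD[OF clinear])+

lemma scaleR: "E (r *\<^sub>R x) = r *\<^sub>R E x"
  by (simp add: scaleR_scaleC scaleC)

lemma selfadjoint:
  assumes "star h = h"
  shows "star (E h) = E h"
  using norm_positive_star[OF pos[OF norm_positive_norm_minus[OF assms order_refl]]]
  by (simp add: diff scaleR star_diff star_scaleR)

lemma star: "E (star x) = star (E x)"
proof -
  obtain h k where h: "star h = h" "star k = k" "x = h + \<i> *\<^sub>C k"
    using cartesian_decomposition[of x] by metis
  show ?thesis unfolding h(3)
    by (simp add: star_simps add scaleC h(1,2) selfadjoint[OF h(1)] selfadjoint[OF h(2)]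
        complex_vector.scale_minus_left minus diff)
qed

text \<open>The element \<open>norm h *\<^sub>R 1 + E h\<close> lies between 0 and
  \<open>2 * norm h\<close>; removing the multiple of 1 costs another \<open>norm h\<close>. Real
  and imaginary parts then give the constant 6 in \<open>norm_bound\<close>. These constants are not
  sharp: they serve only continuity and the boundedness argument for derivations.\<close>

lemma norm_selfadjoint_le:
  assumes "star h = h"
  shows "norm (E h) \<le> 3 * norm h"
proof -
  have 1: "norm_positive (norm h *\<^sub>R 1 + E h)" "norm_positive (norm h *\<^sub>R 1 - E h)"
    using pos[OF norm_positive_norm_plus[OF assms order_refl]]
      pos[OF norm_positive_norm_minus[OF assms order_refl]] by (simp_all add: add diff scaleR)
  have "norm (norm h *\<^sub>R 1 + E h) \<le> 2 * norm h"
  proof (rule norm_positive_norm_le[OF 1(1)])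
    have "(2 * norm h) *\<^sub>R 1 - (norm h *\<^sub>R 1 + E h) = norm h *\<^sub>R 1 - E h"
      by (simp add: scaleR_2 flip: scaleR_scaleR)
    then show "norm_positive ((2 * norm h) *\<^sub>R 1 - (norm h *\<^sub>R 1 + E h))" using 1(2) by (simp only:)
  qed simp
  then show ?thesis
    using norm_triangle_ineq4[of "norm h *\<^sub>R 1 + E h" "norm h *\<^sub>R 1"] by simp
qed

lemma norm_bound: "norm (E x) \<le> 6 * norm x"
proof -
  obtain h k where h: "star h = h" "star k = k" "x = h + \<i> *\<^sub>C k" "norm h \<le> norm x" "norm k \<le> norm x"
    using cartesian_decomposition[of x] by metis
  have "norm (E x) \<le> norm (E h) + norm (E k)"
    using norm_triangle_ineq[of "E h" "\<i> *\<^sub>C E k"] by (simp add: h(3) add scaleC norm_scaleC)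
  then show ?thesis
    using norm_selfadjoint_le[OF h(1)] norm_selfadjoint_le[OF h(2)] h(4,5) by simp
qed

lemma bounded_linear: "bounded_linear E"
  by (rule bounded_linear_intro[where K = 6]) (simp_all add: add scaleR norm_bound mult.commute[of _ 6])

lemma subspace_fixed: "subspace {x. E x = x}"
  by (auto simp: subspace_def add scaleR zero)

lemma closed_fixed: "closed {x. E x = x}"
  by (intro closed_Collect_eq continuous_intros bounded_linear.continuous_on[OF bounded_linear])

text \<open>The sum over the Bernstein polynomials \<open>f\<^sub>k\<close> of \<open>a\<close> of
  \<open>(\<mu> + k \<delta> - m) E(f f\<^sub>k) (\<mu> + k \<delta> - m)\<close> is nonnegative; \<open>(\<Sum>k. k f\<^sub>k)\<close> and \<open>(\<Sum>k. k\<^sup>2 f\<^sub>k)\<close> are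
  replaced by their values.\<close>

lemma bernstein_positive:
  assumes a: "norm_positive a" "norm_positive (1 - a)" and m: "star m = m"
    and "norm_positive f" "f * a = a * f"
  shows "norm_positive
    (\<mu>\<^sup>2 *\<^sub>R E f + (2 * \<mu> * n * \<delta> + n * \<delta>\<^sup>2) *\<^sub>R E (f * a) + ((real n)\<^sup>2 - n) *\<^sub>R \<delta>\<^sup>2 *\<^sub>R E (f * a * a)
      - m * (\<mu> *\<^sub>R E f + (n * \<delta>) *\<^sub>R E (f * a)) - (\<mu> *\<^sub>R E f + (n * \<delta>) *\<^sub>R E (f * a)) * m
      + m * E f * m)"
  using assms(4,5)
proof (induction n arbitrary: f \<mu>)
  case 0
  have "norm_positive (star (m - \<mu> *\<^sub>R 1) * E f * (m - \<mu> *\<^sub>R 1))"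
    by (intro norm_positive_conjugate pos 0)
  then show ?case by (simp add: star_simps m algebra_simps power2_eq_square)
next
  case (Suc n)
  let ?\<Phi> = "\<lambda>n f \<mu>. \<mu>\<^sup>2 *\<^sub>R E f + (2 * \<mu> * n * \<delta> + n * \<delta>\<^sup>2) *\<^sub>R E (f * a) + (n\<^sup>2 - n) *\<^sub>R \<delta>\<^sup>2 *\<^sub>R E (f * a * a)
      - m * (\<mu> *\<^sub>R E f + (n * \<delta>) *\<^sub>R E (f * a)) - (\<mu> *\<^sub>R E f + (n * \<delta>) *\<^sub>R E (f * a)) * m
      + m * E f * m"
  note fa = \<open>f * a = a * f\<close>
  have c: "f * (1 - a) * a = a * (f * (1 - a))" "f * a * a = a * (f * a)"
    using fa by (simp_all add: algebra_simps)
  \<comment> \<open>The recursion of the Bernstein basis: \<open>f\<close> splits into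
    \<open>f * (1 - a)\<close>, which keeps the node \<open>\<mu>\<close>, and \<open>f * a\<close>,
    which moves it to \<open>\<mu> + \<delta>\<close>.\<close>
  have "norm_positive (?\<Phi> n (f * (1 - a)) \<mu>)"
    by (rule Suc.IH[OF norm_positive_mult[OF Suc.prems(1) a(2)] c(1)]) (simp add: algebra_simps fa)
  moreover have "norm_positive (?\<Phi> n (f * a) (\<mu> + \<delta>))"
    by (rule Suc.IH[OF norm_positive_mult[OF Suc.prems(1) a(1) fa] c(2)])
  moreover have "?\<Phi> n (f * (1 - a)) \<mu> + ?\<Phi> n (f * a) (\<mu> + \<delta>) = ?\<Phi> (Suc n) f \<mu>"
    by (simp add: algebra_simps diff add power2_eq_square scaleR_2) (simp flip: scaleR_add_left)
  ultimately show ?case using norm_positive_add by metis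
qed

text \<open>The Bernstein sum is taken with \<open>f = 1\<close>, \<open>m = E a\<close> and the
  nodes \<open>k / N\<close>. The second moment of the binomial distribution turns it into
  \<open>E (a * a) - E a * E a\<close> plus the variance term \<open>(E a - E (a * a)) / N\<close>,
  which disappears as \<open>N\<close> grows.\<close>

lemma kadison_unit_interval:
  assumes a: "norm_positive a" "norm_positive (1 - a)"
  shows "norm_positive (E (a * a) - E a * E a)"
proof (rule norm_positive_approx)
  fix e :: real assume "e > 0"
  let ?c = "norm (E a - E (a * a))"
  obtain n :: nat where n: "?c / e < real n" using reals_Archimedean2 by blast
  define N where "N = real (Suc n)"
  have N: "N > 0" "?c / e \<le> N" using n by (simp_all add: N_def)
  let ?b = "(1/N) *\<^sub>R E a + (1 - 1/N) *\<^sub>R E (a * a) - E a * E a"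
  have c: "N * (1/N) = 1" "N * (1/N)\<^sup>2 = 1/N" "(N\<^sup>2 - N) * (1/N)\<^sup>2 = 1 - 1/N"
    using N(1) by (simp_all add: power2_eq_square field_simps)
  have "norm_positive (0 + (0 + N * (1/N)\<^sup>2) *\<^sub>R E a + ((N\<^sup>2 - N) * (1/N)\<^sup>2) *\<^sub>R E (a * a)
      - E a * (0 + (N * (1/N)) *\<^sub>R E a) - (0 + (N * (1/N)) *\<^sub>R E a) * E a + E a * 1 * E a)"
    using bernstein_positive[OF a selfadjoint[OF norm_positive_star[OF a(1)]]
        norm_positive_scaleR_one[of 1, simplified], of 0 "Suc n" "1/N", folded N_def] by simp
  then have "norm_positive ?b" using N(1) by (simp add: c)
  moreover have "E (a * a) - E a * E a - ?b = (- 1/N) *\<^sub>R (E a - E (a * a))"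
    by (simp add: algebra_simps)
  then have "norm (E (a * a) - E a * E a - ?b) = ?c / N" using N(1) by simp
  moreover have "?c / N \<le> e" using N \<open>e > 0\<close> by (simp add: field_simps)
  ultimately show "\<exists>b. norm_positive b \<and> norm (E (a * a) - E a * E a - b) \<le> e" by metis
qed

lemma kadison:
  assumes "star x = x"
  shows "norm_positive (E (x * x) - E x * E x)"
proof -
  \<comment> \<open>Any \<open>t \<ge> norm x\<close> maps \<open>x\<close> affinely into the unit
    interval; the added 1 keeps \<open>t\<close> positive for \<open>x = 0\<close>. The defect in
    Kadison's inequality ignores added scalars and scales quadratically.\<close>
  define t where "t = norm x + 1"
  have t: "t > 0" "norm x \<le> t" by (simp_all add: t_def add_nonneg_pos)
  define a where "a = (1 / (2 * t)) *\<^sub>R (t *\<^sub>R 1 + x)"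
  have a: "norm_positive a"
    unfolding a_def using t assms by (intro norm_positive_scaleR norm_positive_norm_plus) auto
  have "1 - a = (1 / (2 * t)) *\<^sub>R (t *\<^sub>R 1 - x)"
  proof -
    have "1 = (1 / (2 * t)) *\<^sub>R ((2 * t) *\<^sub>R (1::'a))" using t by simp
    then have "1 - a = (1 / (2 * t)) *\<^sub>R ((2 * t) *\<^sub>R 1 - (t *\<^sub>R 1 + x))"
      by (simp only: a_def scaleR_right_diff_distrib)
    also have "(2 * t) *\<^sub>R 1 - (t *\<^sub>R 1 + x) = t *\<^sub>R 1 - x"
      by (simp add: scaleR_2 flip: scaleR_scaleR)
    finally show ?thesis .
  qed
  then have a': "norm_positive (1 - a)"
    using t assms by (simp add: norm_positive_scaleR norm_positive_norm_minus)
  have x: "x = (2 * t) *\<^sub>R a - t *\<^sub>R 1" using t by (simp add: a_def)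
  have "E (x * x) - E x * E x = (2 * t)\<^sup>2 *\<^sub>R (E (a * a) - E a * E a)"
    unfolding x by (simp add: algebra_simps add diff scaleR power2_eq_square scaleR_2)
  then show ?thesis using norm_positive_scaleR[OF kadison_unit_interval[OF a a']] by simp
qed

section \<open>The Jordan identity on the range\<close>

text \<open>The Kadison defect of \<open>b + r *\<^sub>R x\<close> is a quadratic polynomial in
  \<open>r\<close> whose constant term \<open>E (b * b) - b * b\<close> vanishes. As it is positive
  for \<open>r\<close> of either sign, dividing by the modulus of \<open>r\<close> and letting
  \<open>r\<close> tend to 0 shows that \<open>Y\<close> and \<open>- Y\<close> are both
  positive.\<close>

lemma jordan_selfadjoint:
  assumes b: "E b = b" "star b = b" and x: "star x = x"
  shows "E (b * x + x * b) = b * E x + E x * b"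
proof -
  define Y where "Y = E (b * x + x * b) - (b * E x + E x * b)"
  define Z where "Z = E (x * x) - E x * E x"
  have *: "norm_positive (r *\<^sub>R Y + (r * r) *\<^sub>R Z)" for r
  proof -
    have "norm_positive (E ((b + r *\<^sub>R x) * (b + r *\<^sub>R x)) - E (b + r *\<^sub>R x) * E (b + r *\<^sub>R x))"
      by (rule kadison) (simp add: star_simps b x)
    also have "E ((b + r *\<^sub>R x) * (b + r *\<^sub>R x)) - E (b + r *\<^sub>R x) * E (b + r *\<^sub>R x) = r *\<^sub>R Y + (r * r) *\<^sub>R Z"
      by (simp add: Y_def Z_def algebra_simps add scaleR b fixed_mult[OF b(1) b(1)])
    finally show ?thesis .
  qed
  have lim: "norm_positive (s *\<^sub>R Y)" if s: "s * s = 1" for s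
  proof (rule norm_positive_approx)
    fix e :: real assume "e > 0"
    define r where "r = e / (norm Z + 1)"
    have r: "r > 0" using \<open>e > 0\<close> by (simp add: r_def add_nonneg_pos)
    have "norm_positive ((1/r) *\<^sub>R ((s * r) *\<^sub>R Y + (s * r * (s * r)) *\<^sub>R Z))"
      using r by (intro norm_positive_scaleR *) simp
    moreover have "s * r * (s * r) = r * r" using s by (simp add: mult.assoc mult.left_commute)
    then have "(1/r) *\<^sub>R ((s * r) *\<^sub>R Y + (s * r * (s * r)) *\<^sub>R Z) = s *\<^sub>R Y + r *\<^sub>R Z"
      using r by (simp add: scaleR_right_distrib)
    moreover have "norm (s *\<^sub>R Y - (s *\<^sub>R Y + r *\<^sub>R Z)) \<le> e"
    proof -
      have "r * norm Z \<le> r * (norm Z + 1)" using r by simp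
      also have "\<dots> = e" using add_nonneg_pos[OF norm_ge_zero[of Z] zero_less_one] by (simp add: r_def)
      finally show ?thesis using r by simp
    qed
    ultimately show "\<exists>b. norm_positive b \<and> norm (s *\<^sub>R Y - b) \<le> e" by metis
  qed
  have "Y = 0" using norm_positive_antisym[of Y] lim[of 1] lim[of "-1"] by simp
  then show ?thesis by (simp add: Y_def)
qed

lemma fixed_decomposition:
  assumes "E b = b"
  obtains h k where "star h = h" "star k = k" "b = h + \<i> *\<^sub>C k" "E h = h" "E k = k"
proof -
  obtain h k where h: "star h = h" "star k = k" "b = h + \<i> *\<^sub>C k"
    using cartesian_decomposition[of b] by metis
  have "E h + \<i> *\<^sub>C E k = h + \<i> *\<^sub>C k" using assms by (simp add: h(3) add scaleC)
  then show thesis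
    using cartesian_unique[OF _ selfadjoint selfadjoint, of h k h k] h that by simp
qed

lemma kernel_decomposition:
  assumes "E b = 0"
  obtains h k where "star h = h" "star k = k" "b = h + \<i> *\<^sub>C k" "E h = 0" "E k = 0"
proof -
  obtain h k where h: "star h = h" "star k = k" "b = h + \<i> *\<^sub>C k"
    using cartesian_decomposition[of b] by metis
  have "E h + \<i> *\<^sub>C E k = 0 + \<i> *\<^sub>C 0"
    using assms by (simp add: h(3) add scaleC complex_vector.scale_zero_right)
  then show thesis
    using cartesian_unique[OF _ selfadjoint selfadjoint, of h k 0 0] h that by simp
qed

lemma jordan:
  assumes b: "E b = b"
  shows "E (b * x + x * b) = b * E x + E x * b"
proof -
  obtain h k where h: "star h = h" "star k = k" "b = h + \<i> *\<^sub>C k" "E h = h" "E k = k"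
    using fixed_decomposition[OF b] by metis
  obtain p q where p: "star p = p" "star q = q" "x = p + \<i> *\<^sub>C q"
    using cartesian_decomposition[of x] by metis
  have *: "E (c * y) = c * E y + E y * c - E (y * c)"
    if "E c = c" "star c = c" "star y = y" for c y
    using jordan_selfadjoint[OF that] by (simp add: add algebra_simps)
  show ?thesis
    unfolding h(3) p(3)
    by (simp add: distrib_left distrib_right scaleC_simps add scaleC
        *[OF h(4,1) p(1)] *[OF h(4,1) p(2)] *[OF h(5,2) p(1)] *[OF h(5,2) p(2)] h(4,5) minus diff)
qed

end

lemma norm_isometry_mult:
  fixes w :: "'a::unital_cstar_algebra"
  assumes "star w * w = 1"
  shows "norm (w ^ n * x) = norm x"
proof (induction n)
  case (Suc n)
  have "norm (w * y) = norm y" for y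
  proof -
    have "star (w * y) * (w * y) = star y * (star w * w) * y" by (simp add: star_mult mult.assoc)
    then have "(norm (w * y))\<^sup>2 = (norm y)\<^sup>2"
      using cstar_identity[of "w * y"] cstar_identity[of y] by (simp add: assms)
    then show ?thesis by simp
  qed
  then show ?case using Suc by (simp add: mult.assoc)
qed simp

text \<open>For self-adjoint \<open>a\<close> in the kernel, the map \<open>b \<mapsto> E (b * a)\<close> on the range vanishes: the Jordan
  identity makes it vanish on commutators, hence each self-adjoint \<open>b\<close> commutes with its image, and
  unitaries \<open>w\<close> obey the power rule \<open>w\<^sup>n \<mapsto> n w\<^sup>n\<^sup>-\<^sup>1 E (w * a)\<close>, which contradicts boundedness
  unless \<open>E (w * a) = 0\<close>.\<close>

locale kernel_element = unital_positive_projection +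
  fixes a
  assumes a: "star a = a" "E a = 0"
begin

text \<open>For \<open>b\<close> in the range, the Jordan identity makes this half of
  \<open>E (b * a - a * b)\<close>, an inner derivation compressed by \<open>E\<close>.\<close>

definition der :: "'a \<Rightarrow> 'a" where
  "der b = E (b * a)"

lemma der_fixed: "E (der b) = der b"
  by (simp add: der_def idem)

lemma der_add: "der (b + c) = der b + der c"
  by (simp add: der_def distrib_right add)

lemma der_diff: "der (b - c) = der b - der c"
  by (simp add: der_def left_diff_distrib diff)

lemma der_scaleC: "der (z *\<^sub>C b) = z *\<^sub>C der b"
  by (simp add: der_def mult_scaleC_left scaleC)

lemma der_right:
  assumes "E b = b"
  shows "E (a * b) = - der b"
proof -
  have "E (b * a) + E (a * b) = 0" using jordan[OF assms, of a] by (simp add: a add)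
  then show ?thesis by (simp add: der_def add_eq_0_iff)
qed

text \<open>A symmetrized Leibniz rule. The Jordan identities for \<open>b\<close> with
  \<open>c * a\<close> and for \<open>c\<close> with \<open>a * b\<close> share the unknown
  \<open>E (c * a * b)\<close>, which cancels on addition. The right-hand side is symmetric in
  \<open>b\<close> and \<open>c\<close>; this is what \<open>der_swap\<close> exploits.\<close>

lemma der_mult:
  assumes b: "E b = b" and c: "E c = c"
  shows "2 *\<^sub>R der (b * c) = b * der c + der c * b + c * der b + der b * c"
proof -
  have 1: "E (b * (c * a)) + E (c * a * b) = b * der c + der c * b"
    using jordan[OF b, of "c * a"] by (simp add: der_def add)
  have 2: "E (c * (a * b)) + E (a * b * c) = - (c * der b + der b * c)"
    using jordan[OF c, of "a * b"] by (simp add: der_right[OF b] add)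
  have 3: "E (a * b * c) = - der (b * c)"
    using der_right[OF fixed_mult[OF b c]] by (simp add: mult.assoc)
  have 4: "E (b * (c * a)) = der (b * c)" by (simp add: der_def mult.assoc)
  have 5: "E (c * (a * b)) = E (c * a * b)" by (simp add: mult.assoc)
  have "der (b * c) = b * der c + der c * b - E (c * a * b)"
    using 1 unfolding 4 by (simp add: algebra_simps)
  moreover have "der (b * c) = E (c * a * b) + (c * der b + der b * c)"
    using 2 unfolding 3 5 by (simp add: algebra_simps)
  ultimately have "2 *\<^sub>R der (b * c)
      = (b * der c + der c * b - E (c * a * b)) + (E (c * a * b) + (c * der b + der b * c))"
    by (metis scaleR_2)
  then show ?thesis by simp
qed

lemma der_swap:
  assumes "E b = b" "E c = c"
  shows "der (b * c) = der (c * b)"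
proof -
  have "2 *\<^sub>R der (b * c) = 2 *\<^sub>R der (c * b)"
    unfolding der_mult[OF assms] der_mult[OF assms(2,1)] by (simp add: add_ac)
  then show ?thesis by simp
qed

lemma der_selfadjoint:
  assumes "E b = b" "star b = b"
  shows "star (der b) = - der b"
proof -
  have "star (der b) = E (a * b)" by (simp add: der_def star_mult a assms flip: star)
  then show ?thesis by (simp add: der_right assms)
qed

text \<open>Both the commutator \<open>?q\<close> and \<open>b * ?q\<close>, itself the commutator
  of \<open>b\<close> and \<open>b * c\<close>, are annihilated by \<open>der\<close>, so two of the
  four terms survive in the Leibniz rule for \<open>b * ?q\<close>.\<close>

lemma der_anticommutes_commutator:
  assumes b: "E b = b" and c: "E c = c"
  shows "(b * c - c * b) * der b + der b * (b * c - c * b) = 0"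
proof -
  let ?q = "b * c - c * b"
  have q: "E ?q = ?q" by (simp add: diff fixed_mult b c)
  have "der ?q = 0" by (simp add: der_diff der_swap[OF b c])
  moreover have "b * ?q = b * (b * c) - (b * c) * b" by (simp add: algebra_simps)
  then have "der (b * ?q) = 0"
    using der_swap[OF b fixed_mult[OF b c]] by (simp only: der_diff) simp
  ultimately show ?thesis using der_mult[OF b q] by simp
qed

text \<open>Since \<open>der b\<close> lies in the range, the previous lemma applies with
  \<open>c = der b\<close> and with \<open>c = b * der b\<close>. Subtracting \<open>b\<close> times
  the first relation from the second leaves \<open>k * k = 0\<close> for the commutator
  \<open>k\<close>, and \<open>k\<close> is self-adjoint because \<open>der b\<close> is
  skew.\<close>

lemma der_commutes:
  assumes b: "E b = b" "star b = b"
  shows "b * der b = der b * b"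
proof -
  let ?d = "der b"
  define k where "k = b * ?d - ?d * b"
  have d: "E ?d = ?d" by (rule der_fixed)
  have 1: "k * ?d + ?d * k = 0" unfolding k_def
    by (rule der_anticommutes_commutator[OF b(1) d])
  have "b * (b * ?d) - (b * ?d) * b = b * k" by (simp add: k_def algebra_simps)
  then have 2: "b * k * ?d + ?d * (b * k) = 0"
    using der_anticommutes_commutator[OF b(1) fixed_mult[OF b(1) d]] by simp
  have "b * (k * ?d) = - (b * (?d * k))"
    using 1 by (simp add: add_eq_0_iff flip: mult_minus_right)
  then have "(b * ?d - ?d * b) * k = 0"
    using 2 by (simp add: algebra_simps)
  moreover have "star k = k" by (simp add: k_def star_simps b der_selfadjoint)
  ultimately have "star k * k = 0" by (simp add: k_def)
  then have "k = 0" by (rule cstar_norm_zero)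
  then show ?thesis by (simp add: k_def)
qed

lemma der_commutes_polarized:
  assumes "E b = b" "star b = b" "E c = c" "star c = c"
  shows "b * der c + c * der b = der c * b + der b * c"
  using der_commutes[of "b + c"] der_commutes[OF assms(1,2)] der_commutes[OF assms(3,4)]
  by (simp add: add star_add assms der_add algebra_simps)

text \<open>Commutation of \<open>w\<close> with \<open>der w\<close> turns the symmetrized Leibniz
  rule into the ordinary one. The claim on \<open>E\<close> is carried along because that rule
  requires its arguments to be in the range.\<close>

lemma der_power:
  assumes w: "E w = w" "w * der w = der w * w"
  shows "E (w ^ Suc n) = w ^ Suc n \<and> der (w ^ Suc n) = real (Suc n) *\<^sub>R (w ^ n * der w)"
proof (induction n)
  case (Suc n)
  have comm: "w ^ m * der w = der w * w ^ m" for m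
    by (induction m) (simp_all, metis mult.assoc w(2))
  have "w ^ Suc n * der w = w * (w ^ n * der w)" "der w * w ^ Suc n = w * (w ^ n * der w)"
    "w ^ n * der w * w = w * (w ^ n * der w)"
    using comm[of "Suc n"] w(2) by (simp_all add: mult.assoc) (metis mult.assoc power_commutes)+
  then have "2 *\<^sub>R der (w ^ Suc n * w) = 2 *\<^sub>R (real (Suc (Suc n)) *\<^sub>R (w ^ Suc n * der w))"
    using der_mult[of "w ^ Suc n" w] Suc w(1)
    by (simp add: algebra_simps scaleR_2) (simp flip: scaleR_add_left)
  then have "der (w ^ Suc n * w) = real (Suc (Suc n)) *\<^sub>R (w ^ Suc n * der w)"
    by (simp only: scaleR_cancel_left) simp
  moreover have "E (w ^ Suc n * w) = w ^ Suc n * w" using fixed_mult Suc w(1) by blast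
  moreover have "w ^ Suc n * w = w ^ Suc (Suc n)" by (simp only: power_Suc2)
  ultimately show ?case by simp
qed (simp add: w)

text \<open>The contraction \<open>b\<close> is the real part of
  \<open>w = b + \<i> *\<^sub>C l\<close> with \<open>l\<close> a root of \<open>1 - b * b\<close>,
  which stays in the range by the closure clause for roots. Multiplication by powers of
  \<open>w\<close> preserves norms, so \<open>der (w ^ Suc n)\<close> has norm \<open>Suc n\<close>
  times that of \<open>der w\<close>, yet at most \<open>6 * norm a\<close>.\<close>

lemma der_contraction_zero:
  assumes b: "E b = b" "star b = b" "norm b \<le> 1"
  shows "der b = 0"
proof -
  have "norm_positive (1 - b * b)"
    using norm_one_minus_square_le[OF b(2,3)] norm_positive_norm_minus[of "b * b" 1]
      cstar_identity_selfadjoint[OF b(2)] b by (simp add: star_mult power_le_one)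
  then obtain l where l: "star l = l" "l * l = 1 - b * b"
      "\<And>S. subspace S \<Longrightarrow> closed S \<Longrightarrow> (\<And>x. x \<in> S \<Longrightarrow> x * x \<in> S) \<Longrightarrow> 1 \<in> S \<Longrightarrow> 1 - b * b \<in> S \<Longrightarrow> l \<in> S"
      "\<And>c. (1 - b * b) * c = c * (1 - b * b) \<Longrightarrow> l * c = c * l"
    using norm_positive_sqrt by metis
  have El: "E l = l"
    using l(3)[OF subspace_fixed closed_fixed] by (simp add: fixed_mult diff b(1))
  have lb: "l * b = b * l" by (rule l(4)) (simp add: algebra_simps)
  define w where "w = b + \<i> *\<^sub>C l"
  have Ew: "E w = w" by (simp add: w_def add scaleC El b)
  have dw: "der w = der b + \<i> *\<^sub>C der l" by (simp add: w_def der_add der_scaleC)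
  have "star w * w = b * b + l * l"
    by (simp add: w_def star_simps l(1) b(2) algebra_simps scaleC_simps lb)
  then have unitary: "star w * w = 1" by (simp add: l(2))
  have "w * der w = der w * w"
  proof -
    have "w * der w = b * der b - l * der l + \<i> *\<^sub>C (b * der l + l * der b)"
      unfolding dw unfolding w_def by (simp add: algebra_simps scaleC_simps)
    also have "\<dots> = der b * b - der l * l + \<i> *\<^sub>C (der l * b + der b * l)"
      by (simp only: der_commutes[OF b(1,2)] der_commutes[OF El l(1)]
          der_commutes_polarized[OF b(1,2) El l(1)])
    also have "\<dots> = der w * w"
      unfolding dw unfolding w_def by (simp add: algebra_simps scaleC_simps)
    finally show ?thesis .
  qed
  note der_power = der_power[OF Ew this]
  have bound: "real (Suc n) * norm (der w) \<le> 6 * norm a" for n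
  proof -
    have "real (Suc n) * norm (der w) = norm (der (w ^ Suc n))"
      using der_power[of n] norm_isometry_mult[OF unitary, of n "der w"] by simp
    also have "\<dots> \<le> 6 * norm (w ^ Suc n * a)" unfolding der_def by (rule norm_bound)
    finally show ?thesis by (simp only: norm_isometry_mult[OF unitary])
  qed
  have "der w = 0"
  proof (rule ccontr)
    assume "der w \<noteq> 0"
    then obtain n where "6 * norm a < real n * norm (der w)"
      using ex_less_of_nat_mult[of "norm (der w)"] by auto
    also have "\<dots> \<le> real (Suc n) * norm (der w)" by (intro mult_right_mono) auto
    finally show False using bound[of n] by simp
  qed
  \<comment> \<open>Both \<open>der b\<close> and \<open>der l\<close> are skew, so taking adjoints
    flips the sign of the first term only and separates them.\<close>
  then have 0: "der b + \<i> *\<^sub>C der l = 0" by (simp add: dw)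
  then have "star (der b + \<i> *\<^sub>C der l) = 0" by simp
  then have "- der b + \<i> *\<^sub>C der l = 0"
    by (simp add: star_add star_scaleC der_selfadjoint[OF b(1,2)] der_selfadjoint[OF El l(1)]
        complex_vector.scale_minus_left complex_vector.scale_minus_right)
  then have "(der b + \<i> *\<^sub>C der l) - (- der b + \<i> *\<^sub>C der l) = 0" using 0 by simp
  then have "2 *\<^sub>R der b = 0" by (simp add: scaleR_2)
  then show ?thesis by simp
qed

lemma der_zero:
  assumes "E b = b"
  shows "der b = 0"
proof -
  have sa: "der h = 0" if h: "E h = h" "star h = h" for h
  proof -
    have "der ((1 / (norm h + 1)) *\<^sub>R h) = 0"
      using add_nonneg_pos[OF norm_ge_zero[of h] zero_less_one]
      by (intro der_contraction_zero) (auto simp: scaleR h star_scaleR divide_simps)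
    then show ?thesis
      using add_nonneg_pos[OF norm_ge_zero[of h] zero_less_one] by (simp add: der_def scaleR)
  qed
  obtain h k where h: "star h = h" "star k = k" "b = h + \<i> *\<^sub>C k" "E h = h" "E k = k"
    using fixed_decomposition[OF assms] by metis
  show ?thesis
    by (simp add: h(3) der_add der_scaleC sa[OF h(4,1)] sa[OF h(5,2)] complex_vector.scale_zero_right)
qed

end

section \<open>Bimodule property and contractivity\<close>

context unital_positive_projection
begin

lemma module_left:
  assumes b: "E b = b"
  shows "E (b * x) = b * E x"
proof -
  have "E (x - E x) = 0" by (simp add: diff idem)
  then obtain h k where h: "star h = h" "star k = k" "x - E x = h + \<i> *\<^sub>C k" "E h = 0" "E k = 0"
    by (rule kernel_decomposition)
  have *: "E (b * y) = 0" if "star y = y" "E y = 0" for y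
  proof -
    interpret kernel_element E y by unfold_locales (use that in auto)
    show ?thesis using der_zero[OF b] by (simp add: der_def)
  qed
  have "E (b * (x - E x)) = 0"
    unfolding h(3) by (simp add: distrib_left mult_scaleC_right add scaleC * h(1,2,4,5)
        complex_vector.scale_zero_right)
  then show ?thesis
    by (simp add: right_diff_distrib diff fixed_mult[OF b idem])
qed

lemma module_right:
  assumes b: "E b = b"
  shows "E (x * b) = E x * b"
proof -
  have "E (star b * star x) = star b * E (star x)"
    by (rule module_left) (simp add: star b)
  then have "star (E (x * b)) = star (E x * b)" by (simp add: star_mult flip: star)
  then show ?thesis by (metis star_star)
qed

lemma schwarz: "norm_positive (E (star x * x) - star (E x) * E x)"
proof -
  have Ex: "E (star (E x)) = star (E x)" by (simp add: star idem)
  have "norm_positive (E (star (x - E x) * (x - E x)))"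
    by (intro pos norm_positive_star_mult_self)
  also have "E (star (x - E x) * (x - E x)) = E (star x * x) - star (E x) * E x"
    by (simp add: star_diff left_diff_distrib right_diff_distrib diff idem
        module_left[OF Ex] module_right[OF idem] star)
  finally show ?thesis .
qed

lemma contraction: "norm (E x) \<le> norm x"
proof -
  let ?y = "star x * x"
  have "norm_positive ((norm x)\<^sup>2 *\<^sub>R 1 - ?y)"
    by (rule norm_positive_norm_minus) (simp_all add: star_mult star_star cstar_identity)
  from pos[OF this] have "norm_positive ((norm x)\<^sup>2 *\<^sub>R 1 - E ?y)"
    by (simp add: diff scaleR)
  from norm_positive_add[OF this schwarz[of x]]
  have "norm_positive ((norm x)\<^sup>2 *\<^sub>R 1 - star (E x) * E x)" by simp
  from norm_positive_norm_le[OF norm_positive_star_mult_self this]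
  have "(norm (E x))\<^sup>2 \<le> (norm x)\<^sup>2" by (simp add: cstar_identity)
  then show ?thesis by (simp add: power2_le_iff_abs_le)
qed

end

section \<open>Unitization\<close>

datatype 'a unitization = Unitization (elem: 'a) (scal: complex)

lemma unitization_eqI: "elem u = elem v \<Longrightarrow> scal u = scal v \<Longrightarrow> u = v"
  by (cases u; cases v) simp

text \<open>Left multiplication by \<open>elem u + scal u\<close> on the original algebra, which is
  an ideal of the unitization.\<close>

definition unit_action :: "'a::cstar_algebra unitization \<Rightarrow> 'a \<Rightarrow> 'a" where
  "unit_action u x = elem u * x + scal u *\<^sub>C x"

lemma bounded_linear_unit_action: "bounded_linear (unit_action u)"
proof (rule bounded_linear_intro[where K = "norm (elem u) + cmod (scal u)"])
  show "norm (unit_action u x) \<le> norm x * (norm (elem u) + cmod (scal u))" for x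
    using norm_triangle_ineq[of "elem u * x" "scal u *\<^sub>C x"] norm_mult_ineq[of "elem u" x]
    by (simp add: unit_action_def norm_scaleC algebra_simps)
qed (simp_all add: unit_action_def algebra_simps scaleC_add_right scaleC_scaleR_commute)

instantiation unitization :: (cstar_algebra) real_vector
begin

definition "0 = Unitization 0 0"
definition "u + v = Unitization (elem u + elem v) (scal u + scal v)"
definition "- u = Unitization (- elem u) (- scal u)"
definition "u - v = Unitization (elem u - elem v) (scal u - scal v)"
definition "r *\<^sub>R u = Unitization (r *\<^sub>R elem u) (of_real r * scal u)"
lemma elem_simps [simp]:
  fixes u :: "'a unitization"
  shows "elem 0 = (0::'a)" "elem (u + v) = elem u + elem v" "elem (- u) = - elem u"
    "elem (u - v) = elem u - elem v" "elem (r *\<^sub>R u) = r *\<^sub>R elem u"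
    "scal (0::'a unitization) = 0" "scal (u + v) = scal u + scal v" "scal (- u) = - scal u"
    "scal (u - v) = scal u - scal v" "scal (r *\<^sub>R u) = of_real r * scal u"
  by (simp_all add: zero_unitization_def plus_unitization_def uminus_unitization_def
      minus_unitization_def scaleR_unitization_def)

instance
  by standard (rule unitization_eqI; simp add: algebra_simps)+

end

text \<open>If \<open>'a\<close> already has a unit, the operator norm alone is only a seminorm.\<close>

instantiation unitization :: (cstar_algebra) real_normed_vector
begin

definition "norm u = max (onorm (unit_action u)) (cmod (scal u))"
definition "dist u v = norm (u - v)" for u v :: "'a unitization"
definition "sgn u = u /\<^sub>R norm u" for u :: "'a unitization"
definition "(uniformity :: ('a unitization \<times> 'a unitization) filter) =
  (INF e\<in>{0<..}. principal {(x, y). dist x y < e})"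
definition "open (U :: 'a unitization set) \<longleftrightarrow>
  (\<forall>x\<in>U. eventually (\<lambda>(x', y). x' = x \<longrightarrow> y \<in> U) uniformity)"

lemma unit_action_add: "unit_action (u + v) x = unit_action u x + unit_action v x"
  by (simp add: unit_action_def algebra_simps scaleC_add_left)

lemma unit_action_scaleR: "unit_action (r *\<^sub>R u) x = r *\<^sub>R unit_action u x"
  by (simp add: unit_action_def algebra_simps scaleR_scaleC scaleC_scaleC mult_scaleC_left
      scaleC_add_right)

lemma norm_unit_action_le: "norm (unit_action u x) \<le> norm u * norm x"
proof -
  have "norm (unit_action u x) \<le> onorm (unit_action u) * norm x"
    by (rule onorm[OF bounded_linear_unit_action])
  also have "\<dots> \<le> norm u * norm x"
    by (rule mult_right_mono) (simp_all add: norm_unitization_def)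
  finally show ?thesis .
qed

lemma cmod_scal_le: "cmod (scal u) \<le> norm u"
  by (simp add: norm_unitization_def)

lemma norm_unitization_leI:
  assumes "\<And>x. norm (unit_action u x) \<le> r * norm x" "cmod (scal u) \<le> r"
  shows "norm u \<le> r"
proof -
  have "0 \<le> r" using assms(2) norm_ge_zero order_trans by blast
  then show ?thesis using onorm_bound[of r "unit_action u"] assms by (simp add: norm_unitization_def)
qed

lemma norm_unitization_le: "norm u \<le> norm (elem u) + cmod (scal u)"
proof (rule norm_unitization_leI)
  show "norm (unit_action u x) \<le> (norm (elem u) + cmod (scal u)) * norm x" for x
    using norm_triangle_ineq[of "elem u * x" "scal u *\<^sub>C x"] norm_mult_ineq[of "elem u" x]
    by (simp add: unit_action_def norm_scaleC algebra_simps)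
qed simp

text \<open>By the C*-identity \<open>x = star a\<close> attains the norm of left multiplication by
  \<open>a\<close>.\<close>

lemma norm_le_of_left_mult_bound:
  fixes a :: 'a
  assumes "\<And>x. norm (a * x) \<le> r * norm x" "r \<ge> 0"
  shows "norm a \<le> r"
proof (cases "a = 0")
  case False
  have "norm a * norm a = norm (a * star a)"
    using cstar_identity[of "star a"] by (simp add: star_star power2_eq_square)
  also have "\<dots> \<le> r * norm a" using assms(1)[of "star a"] by simp
  finally show ?thesis using False by simp
qed (use assms in simp)

text \<open>Together with \<open>cmod_scal_le\<close> and \<open>norm_unitization_le\<close> this
  makes the norm equivalent to the sum of the norms of the components, so definiteness and
  completeness can be checked componentwise.\<close>

lemma norm_elem_le: "norm (elem u) \<le> 2 * norm u"
proof (rule norm_le_of_left_mult_bound)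
  fix x
  have "elem u * x = unit_action u x - scal u *\<^sub>C x" by (simp add: unit_action_def)
  then have "norm (elem u * x) \<le> norm (unit_action u x) + cmod (scal u) * norm x"
    using norm_triangle_ineq4[of "unit_action u x" "scal u *\<^sub>C x"] by (simp add: norm_scaleC)
  also have "\<dots> \<le> norm u * norm x + norm u * norm x"
    by (intro add_mono norm_unit_action_le mult_right_mono cmod_scal_le) simp
  finally show "norm (elem u * x) \<le> 2 * norm u * norm x" by (simp add: mult_ac)
next
  show "0 \<le> 2 * norm u" using order_trans[OF norm_ge_zero cmod_scal_le, of u] by simp
qed

instance
proof
  fix u v :: "'a unitization" and r :: real
  show "dist u v = norm (u - v)" by (rule dist_unitization_def)
  show "sgn u = u /\<^sub>R norm u" by (rule sgn_unitization_def)
  show "(uniformity :: ('a unitization \<times> 'a unitization) filter) =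
      (INF e\<in>{0<..}. principal {(x, y). dist x y < e})"
    by (rule uniformity_unitization_def)
  show "open U \<longleftrightarrow> (\<forall>x\<in>U. eventually (\<lambda>(x', y). x' = x \<longrightarrow> y \<in> U) uniformity)"
    for U :: "'a unitization set"
    by (rule open_unitization_def)
  show "norm u = 0 \<longleftrightarrow> u = 0"
  proof
    assume "norm u = 0"
    then show "u = 0" using norm_elem_le[of u] cmod_scal_le[of u] by (intro unitization_eqI) simp_all
  next
    assume "u = 0"
    then show "norm u = 0"
      using norm_unitization_le[of u] order_trans[OF norm_ge_zero cmod_scal_le, of u] by simp
  qed
  show "norm (u + v) \<le> norm u + norm v"
  proof (rule norm_unitization_leI)
    show "norm (unit_action (u + v) x) \<le> (norm u + norm v) * norm x" for x
      unfolding unit_action_add distrib_right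
      by (intro norm_triangle_le add_mono norm_unit_action_le)
    show "cmod (scal (u + v)) \<le> norm u + norm v"
      unfolding elem_simps by (intro norm_triangle_le add_mono cmod_scal_le)
  qed
  have le: "norm (r *\<^sub>R u) \<le> \<bar>r\<bar> * norm u" for r and u :: "'a unitization"
    by (rule norm_unitization_leI)
      (simp_all add: unit_action_scaleR norm_mult mult.assoc mult_left_mono norm_unit_action_le cmod_scal_le)
  show "norm (r *\<^sub>R u) = \<bar>r\<bar> * norm u"
  proof (cases "r = 0")
    case True
    then show ?thesis
      using le[of r u] order_trans[OF norm_ge_zero cmod_scal_le, of "r *\<^sub>R u"] by simp
  next
    case False
    have "(1/r) *\<^sub>R (r *\<^sub>R u) = u" using False by (intro unitization_eqI) simp_all
    then have "norm u \<le> \<bar>1/r\<bar> * norm (r *\<^sub>R u)" using le[of "1/r" "r *\<^sub>R u"] by simp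
    then have "\<bar>r\<bar> * norm u \<le> norm (r *\<^sub>R u)" using False by (simp add: field_simps)
    then show ?thesis using le[of r u] by simp
  qed
qed

end

instantiation unitization :: (cstar_algebra) real_normed_algebra_1
begin

definition "1 = Unitization 0 1"
definition "u * v = Unitization (elem u * elem v + scal v *\<^sub>C elem u + scal u *\<^sub>C elem v) (scal u * scal v)"

lemma elem_times_simps [simp]:
  fixes u :: "'a unitization"
  shows "elem 1 = (0::'a)" "scal (1::'a unitization) = 1"
    "elem (u * v) = elem u * elem v + scal v *\<^sub>C elem u + scal u *\<^sub>C elem v"
    "scal (u * v) = scal u * scal v"
  by (simp_all add: one_unitization_def times_unitization_def)

lemma unit_action_times: "unit_action (u * v) x = unit_action u (unit_action v x)"
  by (simp add: unit_action_def algebra_simps scaleC_simps)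

instance
proof
  fix u v w :: "'a unitization" and r :: real
  show "u * v * w = u * (v * w)" "(u + v) * w = u * w + v * w" "u * (v + w) = u * v + u * w"
    "r *\<^sub>R u * v = r *\<^sub>R (u * v)" "u * r *\<^sub>R v = r *\<^sub>R (u * v)" "1 * u = u" "u * 1 = u"
    by (rule unitization_eqI; simp add: algebra_simps scaleC_simps scaleC_add_left scaleR_scaleC)+
  show "(0::'a unitization) \<noteq> 1" by (metis elem_simps(6) elem_times_simps(2) zero_neq_one)
  show "norm (1::'a unitization) = 1"
  proof (rule antisym)
    show "norm (1::'a unitization) \<le> 1"
      by (rule norm_unitization_leI) (simp_all add: unit_action_def scaleC_one)
    show "1 \<le> norm (1::'a unitization)" using cmod_scal_le[of "1::'a unitization"] by simp
  qed
  show "norm (u * v) \<le> norm u * norm v"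
  proof (rule norm_unitization_leI)
    show "norm (unit_action (u * v) x) \<le> norm u * norm v * norm x" for x
    proof -
      have "norm (unit_action (u * v) x) \<le> norm u * norm (unit_action v x)"
        unfolding unit_action_times by (rule norm_unit_action_le)
      also have "\<dots> \<le> norm u * (norm v * norm x)"
        by (intro mult_left_mono norm_unit_action_le) simp
      finally show ?thesis by (simp add: mult.assoc)
    qed
    show "cmod (scal (u * v)) \<le> norm u * norm v"
      by (simp add: norm_mult mult_mono cmod_scal_le)
  qed
qed

end

instance unitization :: (cstar_algebra) banach
proof
  fix X :: "nat \<Rightarrow> 'a unitization"
  assume X: "Cauchy X"
  have "Cauchy (\<lambda>n. elem (X n))"
  proof (rule CauchyI)
    fix e :: real assume "e > 0"
    then obtain M where M: "\<And>m n. m \<ge> M \<Longrightarrow> n \<ge> M \<Longrightarrow> norm (X m - X n) < e/2"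
      using CauchyD[OF X, of "e/2"] by auto
    have "norm (elem (X m) - elem (X n)) < e" if "m \<ge> M" "n \<ge> M" for m n
      using M[OF that] norm_elem_le[of "X m - X n"] by simp
    then show "\<exists>M. \<forall>m\<ge>M. \<forall>n\<ge>M. norm (elem (X m) - elem (X n)) < e" by blast
  qed
  then obtain a where a: "(\<lambda>n. elem (X n)) \<longlonglongrightarrow> a" using Cauchy_convergent convergentD by blast
  have "Cauchy (\<lambda>n. scal (X n))"
  proof (rule CauchyI)
    fix e :: real assume "e > 0"
    then obtain M where M: "\<And>m n. m \<ge> M \<Longrightarrow> n \<ge> M \<Longrightarrow> norm (X m - X n) < e"
      using CauchyD[OF X, of e] by auto
    have "cmod (scal (X m) - scal (X n)) < e" if "m \<ge> M" "n \<ge> M" for m n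
      using M[OF that] cmod_scal_le[of "X m - X n"] by simp
    then show "\<exists>M. \<forall>m\<ge>M. \<forall>n\<ge>M. cmod (scal (X m) - scal (X n)) < e" by blast
  qed
  then obtain z where z: "(\<lambda>n. scal (X n)) \<longlonglongrightarrow> z" using Cauchy_convergent convergentD by blast
  have "(\<lambda>n. norm (elem (X n) - a) + cmod (scal (X n) - z)) \<longlonglongrightarrow> norm (a - a) + cmod (z - z)"
    by (intro tendsto_intros a z)
  then have "(\<lambda>n. norm (elem (X n) - a) + cmod (scal (X n) - z)) \<longlonglongrightarrow> 0" by simp
  then have "(\<lambda>n. X n - Unitization a z) \<longlonglongrightarrow> 0"
    by (rule Lim_null_comparison[rotated])
      (use norm_unitization_le[of "X _ - Unitization a z"] in simp)
  then show "convergent X" unfolding convergent_def using LIM_zero_iff by blast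
qed

instantiation unitization :: (cstar_algebra) complex_vector
begin

definition "c *\<^sub>C u = Unitization (c *\<^sub>C elem u) (c * scal u)"

lemma elem_scaleC_simps [simp]:
  fixes u :: "'a unitization"
  shows "elem (c *\<^sub>C u) = c *\<^sub>C elem u" "scal (c *\<^sub>C u) = c * scal u"
  by (simp_all add: scaleC_unitization_def)

instance
  by standard (rule unitization_eqI; simp add: algebra_simps scaleC_add_right scaleC_add_left
      scaleC_scaleC scaleC_one scaleR_scaleC)+

end

instantiation unitization :: (cstar_algebra) unital_cstar_algebra
begin

definition "star u = Unitization (star (elem u)) (cnj (scal u))"

lemma elem_star_simps [simp]:
  fixes u :: "'a unitization"
  shows "elem (star u) = star (elem u)" "scal (star u) = cnj (scal u)"
  by (simp_all add: star_unitization_def)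

lemma unit_action_scaleC: "unit_action (c *\<^sub>C u) x = c *\<^sub>C unit_action u x"
  by (simp add: unit_action_def scaleC_simps)

text \<open>Lets the C*-identity of the original algebra, applied to \<open>unit_action u x\<close>,
  bound the action of \<open>u\<close> by the norm of \<open>star u * u\<close>.\<close>

lemma star_unit_action_mult: "star (unit_action u x) * unit_action u x = star x * unit_action (star u * u) x"
  by (simp add: unit_action_def star_simps algebra_simps scaleC_simps)

instance
proof
  fix u v :: "'a unitization" and c :: complex
  show "c *\<^sub>C u * v = c *\<^sub>C (u * v)" "u * c *\<^sub>C v = c *\<^sub>C (u * v)"
    "star (star u) = u" "star (u + v) = star u + star v" "star (c *\<^sub>C u) = cnj c *\<^sub>C star u"
    "star (u * v) = star v * star u"
    by (rule unitization_eqI; simp add: star_simps algebra_simps scaleC_simps)+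
  have le: "norm (c *\<^sub>C u) \<le> cmod c * norm u" for c and u :: "'a unitization"
    by (rule norm_unitization_leI)
      (simp_all add: unit_action_scaleC norm_scaleC norm_mult mult.assoc mult_left_mono
        norm_unit_action_le cmod_scal_le)
  show "norm (c *\<^sub>C u) = cmod c * norm u"
  proof (cases "c = 0")
    case True
    then show ?thesis using le[of c u] by simp
  next
    case False
    have "norm u \<le> cmod (1/c) * norm (c *\<^sub>C u)"
      using le[of "1/c" "c *\<^sub>C u"] False by (simp add: scaleC_scaleC scaleC_one)
    then have "cmod c * norm u \<le> norm (c *\<^sub>C u)"
      using False by (simp add: norm_divide field_simps)
    then show ?thesis using le[of c u] by simp
  qed
  have sq: "(norm u)\<^sup>2 \<le> norm (star u * u)" for u :: "'a unitization"
  proof -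
    have "norm u \<le> sqrt (norm (star u * u))"
    proof (rule norm_unitization_leI)
      fix x
      have "(norm (unit_action u x))\<^sup>2 = norm (star x * unit_action (star u * u) x)"
        by (simp flip: cstar_identity star_unit_action_mult)
      also have "\<dots> \<le> norm x * (norm (star u * u) * norm x)"
        using norm_mult_ineq[of "star x" "unit_action (star u * u) x"]
          mult_left_mono[OF norm_unit_action_le[of "star u * u" x] norm_ge_zero[of x]] by simp
      finally have "(norm (unit_action u x))\<^sup>2 \<le> (sqrt (norm (star u * u)) * norm x)\<^sup>2"
        by (simp add: power_mult_distrib) (simp add: power2_eq_square mult_ac)
      then show "norm (unit_action u x) \<le> sqrt (norm (star u * u)) * norm x"
        by (rule power2_le_imp_le) simp
      show "cmod (scal u) \<le> sqrt (norm (star u * u))"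
        using cmod_scal_le[of "star u * u"] by (intro real_le_rsqrt) (simp add: norm_mult power2_eq_square)
    qed
    then show ?thesis by (metis norm_ge_zero real_sqrt_pow2 power_mono)
  qed
  have star_le: "norm u \<le> norm (star u)" for u :: "'a unitization"
  proof (cases "u = 0")
    case False
    have "norm u * norm u \<le> norm (star u) * norm u"
      using sq[of u] norm_mult_ineq[of "star u" u] by (simp add: power2_eq_square)
    then show ?thesis using False by simp
  qed simp
  have "star (star u) = u" by (rule unitization_eqI) (simp_all add: star_star)
  then have "norm (star u) \<le> norm u" using star_le[of "star u"] by simp
  then have "norm (star u * u) \<le> (norm u)\<^sup>2"
    using norm_mult_ineq[of "star u" u] mult_right_mono[of "norm (star u)" "norm u" "norm u"]
    by (simp add: power2_eq_square)
  then show "norm (star u * u) = (norm u)\<^sup>2" using sq[of u] by simp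
qed

end

lemma norm_Unitization: "norm (Unitization a 0) = norm a"
proof (rule antisym)
  show "norm (Unitization a 0) \<le> norm a" using norm_unitization_le[of "Unitization a 0"] by simp
  show "norm a \<le> norm (Unitization a 0)"
    by (rule norm_le_of_left_mult_bound)
      (use norm_unit_action_le[of "Unitization a 0"] in \<open>simp_all add: unit_action_def\<close>)
qed

section \<open>States\<close>

definition sublinear :: "('a::real_vector \<Rightarrow> real) \<Rightarrow> bool" where
  "sublinear q \<longleftrightarrow> q 0 = 0 \<and> (\<forall>x y. q (x + y) \<le> q x + q y) \<and> (\<forall>t>0. \<forall>x. q (t *\<^sub>R x) \<le> t * q x)"

lemma sublinearD:
  assumes "sublinear q"
  shows "q 0 = 0" "q (x + y) \<le> q x + q y" "t > 0 \<Longrightarrow> q (t *\<^sub>R x) = t * q x"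
    "- q (- x) \<le> q x"
proof -
  show 1: "q 0 = 0" "q (x + y) \<le> q x + q y" for x y using assms by (auto simp: sublinear_def)
  show "- q (- x) \<le> q x" using 1(1) 1(2)[of x "- x"] by simp
  assume t: "t > 0"
  have "q (t *\<^sub>R x) \<le> t * q x" using assms t by (auto simp: sublinear_def)
  moreover have "q ((1/t) *\<^sub>R (t *\<^sub>R x)) \<le> (1/t) * q (t *\<^sub>R x)"
    using assms t unfolding sublinear_def by (metis divide_pos_pos zero_less_one)
  then have "t * q x \<le> q (t *\<^sub>R x)" using t by (simp add: field_simps)
  ultimately show "q (t *\<^sub>R x) = t * q x" by simp
qed

text \<open>The functional is the infimum over \<open>t \<ge> 0\<close> of
  \<open>q (x + t *\<^sub>R y) - t * q y\<close>; \<open>t = 0\<close> and \<open>t = 1\<close> give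
  the two bounds. A minimal \<open>q\<close> must coincide with \<open>q'\<close>, and then the
  second bound is superadditivity.\<close>

lemma sublinear_shift:
  assumes q: "sublinear q"
  obtains q' where "sublinear q'" "\<And>x. q' x \<le> q x" "\<And>x. q' x \<le> q (x + y) - q y"
proof -
  define q' where "q' x = (INF t\<in>{0..}. q (x + t *\<^sub>R y) - t * q y)" for x
  have hom: "q (t *\<^sub>R y) = t * q y" if "t \<ge> 0" for t
    using sublinearD(1)[OF q] sublinearD(3)[OF q, of t y] that by (cases "t = 0") auto
  have lower: "- q (- x) \<le> q (x + t *\<^sub>R y) - t * q y" if "t \<ge> 0" for x t
    using sublinearD(2)[OF q, of "x + t *\<^sub>R y" "- x"] hom[OF that] by simp
  have bdd: "bdd_below ((\<lambda>t. q (x + t *\<^sub>R y) - t * q y) ` {0..})" for x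
    using lower by (intro bdd_belowI2) auto
  have le: "q' x \<le> q (x + t *\<^sub>R y) - t * q y" if "t \<ge> 0" for x t
    unfolding q'_def using bdd that by (intro cINF_lower) auto
  have ge: "r \<le> q' x" if "\<And>t. t \<ge> 0 \<Longrightarrow> r \<le> q (x + t *\<^sub>R y) - t * q y" for x r
    unfolding q'_def using that by (intro cINF_greatest) auto
  have "sublinear q'"
    unfolding sublinear_def
  proof (intro conjI allI impI)
    show "q' 0 = 0"
      using le[of 0 0] ge[of 0 0] lower[of _ 0] sublinearD(1)[OF q] by fastforce
    fix x z
    have "q' (x + z) - (q (z + s *\<^sub>R y) - s * q y) \<le> q (x + t *\<^sub>R y) - t * q y"
      if "s \<ge> 0" "t \<ge> 0" for s t
      using le[of "s + t" "x + z"] sublinearD(2)[OF q, of "x + t *\<^sub>R y" "z + s *\<^sub>R y"] that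
      by (simp add: algebra_simps)
    then have "q' (x + z) - (q (z + s *\<^sub>R y) - s * q y) \<le> q' x" if "s \<ge> 0" for s
      using that ge by blast
    then have "q' (x + z) - q' x \<le> q (z + s *\<^sub>R y) - s * q y" if "s \<ge> 0" for s
      using that by (simp add: algebra_simps)
    then have "q' (x + z) - q' x \<le> q' z" using ge by blast
    then show "q' (x + z) \<le> q' x + q' z" by simp
  next
    fix r :: real and x assume r: "r > 0"
    have "q' (r *\<^sub>R x) / r \<le> q (x + t *\<^sub>R y) - t * q y" if "t \<ge> 0" for t
      using le[of "r * t" "r *\<^sub>R x"] sublinearD(3)[OF q r, of "x + t *\<^sub>R y"] r that
      by (simp add: field_simps scaleR_right_distrib)
    then have "q' (r *\<^sub>R x) / r \<le> q' x" using ge by blast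
    then show "q' (r *\<^sub>R x) \<le> r * q' x" using r by (simp add: field_simps)
  qed
  moreover have "q' x \<le> q x" "q' x \<le> q (x + y) - q y" for x
    using le[of 0 x] le[of 1 x] by simp_all
  ultimately show thesis using that by blast
qed

text \<open>Zorn's lemma for the reversed order. A chain is bounded by its pointwise infimum, finite
  because each member is at least \<open>- p (- x)\<close>; comparability of any two members makes
  the infimum subadditive.\<close>

lemma minimal_sublinear_exists:
  assumes p: "sublinear p"
  obtains q where "sublinear q" "\<And>x. q x \<le> p x"
    "\<And>q'. sublinear q' \<Longrightarrow> (\<And>x. q' x \<le> q x) \<Longrightarrow> q' = q"
proof -
  define A where "A = {q. sublinear q \<and> q \<le> p}"
  have "\<exists>m\<in>A. \<forall>a\<in>A. a \<le> m \<longrightarrow> a = m"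
  proof (rule predicate_Zorn)
    show "partial_order_on A (relation_of (\<lambda>a b. b \<le> a) A)"
      by (rule partial_order_on_relation_ofI) auto
    fix C assume C: "C \<in> Chains (relation_of (\<lambda>a b. b \<le> a) A)"
    then have CA: "C \<subseteq> A" by (rule Chains_relation_of)
    have chain: "q \<le> q' \<or> q' \<le> q" if "q \<in> C" "q' \<in> C" for q q'
      using C that by (auto simp: Chains_def relation_of_def)
    show "\<exists>u\<in>A. \<forall>a\<in>C. u \<le> a"
    proof (cases "C = {}")
      case True
      then show ?thesis using p by (intro bexI[of _ p]) (auto simp: A_def)
    next
      case False
      define u where "u x = (INF q\<in>C. q x)" for x
      have lower: "- p (- x) \<le> q x" if "q \<in> C" for q x
      proof -
        have "sublinear q" "q (- x) \<le> p (- x)" using that CA by (auto simp: A_def le_fun_def)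
        then show ?thesis using sublinearD(4)[of q x] by simp
      qed
      have le: "u x \<le> q x" if "q \<in> C" for q x
        unfolding u_def using that lower by (intro cINF_lower bdd_belowI2) auto
      have ge: "r \<le> u x" if "\<And>q. q \<in> C \<Longrightarrow> r \<le> q x" for r x
        unfolding u_def using that False by (intro cINF_greatest) auto
      have sub: "sublinear q" if "q \<in> C" for q using that CA by (auto simp: A_def)
      obtain q0 where q0: "q0 \<in> C" using False by blast
      have "sublinear u"
        unfolding sublinear_def
      proof (intro conjI allI impI)
        show "u 0 = 0"
          using le[OF q0, of 0] ge[of 0 0] sublinearD(1)[OF sub] q0 by fastforce
        fix x z
        have "u (x + z) \<le> q x + q' z" if "q \<in> C" "q' \<in> C" for q q'
          using chain[OF that]
        proof
          assume "q \<le> q'"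
          then show ?thesis
            using le[OF that(1), of "x + z"] sublinearD(2)[OF sub[OF that(1)], of x z]
              le_funD[of q q' z] by linarith
        next
          assume "q' \<le> q"
          then show ?thesis
            using le[OF that(2), of "x + z"] sublinearD(2)[OF sub[OF that(2)], of x z]
              le_funD[of q' q x] by linarith
        qed
        then have "u (x + z) - q' z \<le> u x" if "q' \<in> C" for q'
          using that by (intro ge) (simp add: algebra_simps)
        then have "u (x + z) - u x \<le> u z"
          by (intro ge) (simp add: algebra_simps)
        then show "u (x + z) \<le> u x + u z" by simp
      next
        fix r :: real and x assume r: "r > 0"
        have "u (r *\<^sub>R x) / r \<le> q x" if "q \<in> C" for q
          using le[OF that, of "r *\<^sub>R x"] sublinearD(3)[OF sub[OF that] r, of x] r
          by (simp add: field_simps)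
        then have "u (r *\<^sub>R x) / r \<le> u x" by (rule ge)
        then show "u (r *\<^sub>R x) \<le> r * u x" using r by (simp add: field_simps)
      qed
      moreover have "u \<le> p"
      proof (rule le_funI)
        fix x
        have "q0 x \<le> p x" using q0 CA by (auto simp: A_def le_fun_def)
        then show "u x \<le> p x" using le[OF q0, of x] by simp
      qed
      ultimately show ?thesis using le by (intro bexI[of _ u]) (auto simp: A_def le_fun_def)
    qed
  qed
  then show thesis using that by (auto simp: A_def le_fun_def) (metis (no_types, lifting) order.trans)
qed

text \<open>Minimal sublinear functionals are linear. Shifting \<open>p\<close> by \<open>x0\<close>
  beforehand gives \<open>p' (- x0) \<le> - p x0\<close>, which forces the prescribed value at
  \<open>x0\<close>.\<close>

theorem hahn_banach_sublinear:
  fixes p :: "'a::real_vector \<Rightarrow> real"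
  assumes p: "sublinear p"
  obtains f where "linear f" "\<And>x. f x \<le> p x" "f x0 = p x0"
proof -
  obtain p' where p': "sublinear p'" "\<And>x. p' x \<le> p x" "\<And>x. p' x \<le> p (x + x0) - p x0"
    using sublinear_shift[OF p] by metis
  obtain f where f: "sublinear f" "\<And>x. f x \<le> p' x"
      and min: "\<And>q. sublinear q \<Longrightarrow> (\<And>x. q x \<le> f x) \<Longrightarrow> q = f"
    using minimal_sublinear_exists[OF p'(1)] by metis
  have add: "f (x + y) = f x + f y" for x y
  proof -
    obtain q where q: "sublinear q" "\<And>x. q x \<le> f x" "\<And>x. q x \<le> f (x + y) - f y"
      using sublinear_shift[OF f(1)] by metis
    moreover have "q = f" using q(1,2) by (rule min)
    ultimately have "f x \<le> f (x + y) - f y" by simp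
    then show ?thesis using sublinearD(2)[OF f(1), of x y] by simp
  qed
  have neg: "f (- x) = - f x" for x using add[of x "- x"] sublinearD(1)[OF f(1)] by simp
  have "f (t *\<^sub>R x) = t * f x" for t x
  proof (cases t "0::real" rule: linorder_cases)
    case less
    then show ?thesis using sublinearD(3)[OF f(1), of "- t" x] neg[of "t *\<^sub>R x"] by simp
  qed (use sublinearD(1,3)[OF f(1)] in auto)
  then have "linear f" by (intro linearI) (auto simp: add)
  moreover have "f x \<le> p x" for x using f(2)[of x] p'(2)[of x] by simp
  moreover have "p x0 \<le> f x0"
    using f(2)[of "- x0"] p'(3)[of "- x0"] sublinearD(1)[OF p] by (simp add: neg)
  ultimately show thesis using that by (metis order_antisym)
qed

section \<open>States separate the positive cone\<close>

lemma norm_positive_scaleR_one_iff: "norm_positive (t *\<^sub>R (1::'a::unital_cstar_algebra)) \<longleftrightarrow> 0 \<le> t"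
proof
  assume *: "norm_positive (t *\<^sub>R (1::'a))"
  show "0 \<le> t"
  proof (rule ccontr)
    assume "\<not> 0 \<le> t"
    then have "norm_positive (- (t *\<^sub>R (1::'a)))" using norm_positive_scaleR_one[of "- t"] by simp
    then have "t *\<^sub>R (1::'a) = 0" by (rule norm_positive_antisym[OF *])
    then show False using \<open>\<not> 0 \<le> t\<close> by simp
  qed
qed (rule norm_positive_scaleR_one)

definition re_part :: "'a::cstar_algebra \<Rightarrow> 'a" where
  "re_part x = (1/2) *\<^sub>R (x + star x)"

lemma re_part_simps:
  "re_part (x + y) = re_part x + re_part y" "re_part (r *\<^sub>R x) = r *\<^sub>R re_part x"
  "star (re_part x) = re_part x"
  by (simp_all add: re_part_def star_simps algebra_simps)

lemma norm_re_part_le: "norm (re_part x) \<le> norm x"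
  using norm_triangle_ineq[of x "star x"] by (simp add: re_part_def)

lemma re_part_selfadjoint: "star x = x \<Longrightarrow> re_part x = x"
  using scaleR_half_double[of x] by (simp add: re_part_def)

lemma re_part_scaleC_i: "star x = x \<Longrightarrow> re_part (\<i> *\<^sub>C x) = 0"
  by (simp add: re_part_def star_scaleC complex_vector.scale_minus_left)

text \<open>The least upper bound of the numerical range of the self-adjoint part.\<close>

definition num_sup :: "'a::unital_cstar_algebra \<Rightarrow> real" where
  "num_sup x = Inf {t. norm_positive (t *\<^sub>R 1 - re_part x)}"

text \<open>The infimum is attained because the cone is closed. Bounds on \<open>num_sup\<close>
  thereby become positivity statements and conversely.\<close>

lemma num_sup_le_iff: "num_sup x \<le> t \<longleftrightarrow> norm_positive (t *\<^sub>R 1 - re_part x)"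
proof -
  let ?S = "{t. norm_positive (t *\<^sub>R 1 - re_part x)}"
  have mem: "norm x \<in> ?S" by (simp add: norm_positive_norm_minus norm_re_part_le re_part_simps)
  have lower: "- norm x \<le> t" if "t \<in> ?S" for t
  proof -
    have "norm_positive ((t *\<^sub>R 1 - re_part x) + (norm x *\<^sub>R 1 + re_part x))"
      using that by (intro norm_positive_add norm_positive_norm_plus) (simp_all add: re_part_simps norm_re_part_le)
    then have "norm_positive ((t + norm x) *\<^sub>R (1::'a))" by (simp add: algebra_simps)
    then show ?thesis by (simp add: norm_positive_scaleR_one_iff)
  qed
  then have bdd: "bdd_below ?S" by (rule bdd_belowI)
  have attained: "norm_positive (num_sup x *\<^sub>R 1 - re_part x)"
  proof (rule norm_positive_approx)
    fix e :: real assume "e > 0"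
    then have "Inf ?S < num_sup x + e" by (simp add: num_sup_def)
    then have "\<exists>t\<in>?S. t < num_sup x + e" by (rule cInf_lessD[rotated]) (metis mem empty_iff)
    then obtain t where t: "t \<in> ?S" "t < num_sup x + e" by (elim bexE)
    have "num_sup x \<le> t" unfolding num_sup_def by (rule cInf_lower[OF t(1) bdd])
    have "num_sup x *\<^sub>R 1 - re_part x - (t *\<^sub>R 1 - re_part x) = (num_sup x - t) *\<^sub>R 1"
      by (simp add: algebra_simps)
    then have "norm (num_sup x *\<^sub>R 1 - re_part x - (t *\<^sub>R 1 - re_part x)) \<le> e"
      using t(2) \<open>num_sup x \<le> t\<close> by simp
    then show "\<exists>b. norm_positive b \<and> norm (num_sup x *\<^sub>R 1 - re_part x - b) \<le> e"
      using t(1) by blast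
  qed
  show ?thesis
  proof
    assume "num_sup x \<le> t"
    then have "norm_positive ((num_sup x *\<^sub>R 1 - re_part x) + (t - num_sup x) *\<^sub>R 1)"
      by (intro norm_positive_add attained norm_positive_scaleR_one) simp
    then show "norm_positive (t *\<^sub>R 1 - re_part x)" by (simp add: algebra_simps)
  next
    assume "norm_positive (t *\<^sub>R 1 - re_part x)"
    then show "num_sup x \<le> t" unfolding num_sup_def by (intro cInf_lower bdd) simp
  qed
qed

lemma num_sup_le_norm: "num_sup x \<le> norm x"
  by (simp add: num_sup_le_iff norm_positive_norm_minus norm_re_part_le re_part_simps)

lemma num_sup_add: "num_sup (x + y) \<le> num_sup x + num_sup y"
proof -
  have "norm_positive ((num_sup x *\<^sub>R 1 - re_part x) + (num_sup y *\<^sub>R 1 - re_part y))"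
    by (intro norm_positive_add) (simp_all flip: num_sup_le_iff)
  then show ?thesis by (simp add: num_sup_le_iff re_part_simps algebra_simps)
qed

lemma sublinear_num_sup: "sublinear num_sup"
  unfolding sublinear_def
proof (intro conjI allI impI)
  show "num_sup (x + y) \<le> num_sup x + num_sup y" for x y :: 'a by (rule num_sup_add)
  have "num_sup (0::'a) \<le> num_sup (0::'a) + num_sup (0::'a)" using num_sup_add[of "0::'a" 0] by simp
  then show "num_sup (0::'a) = 0" using num_sup_le_norm[of "0::'a"] by simp
  fix r :: real and x :: 'a assume "r > 0"
  then have "norm_positive (r *\<^sub>R (num_sup x *\<^sub>R 1 - re_part x))"
    by (intro norm_positive_scaleR) (simp_all flip: num_sup_le_iff)
  then show "num_sup (r *\<^sub>R x) \<le> r * num_sup x"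
    by (simp add: num_sup_le_iff re_part_simps scaleR_right_diff_distrib)
qed

text \<open>Normalization at the unit together with the norm bound expresses that the functional has
  norm one.\<close>

definition unital_state :: "('a::unital_cstar_algebra \<Rightarrow> complex) \<Rightarrow> bool" where
  "unital_state \<Phi> \<longleftrightarrow> clinear \<Phi> \<and> (\<forall>x. cmod (\<Phi> x) \<le> norm x) \<and> \<Phi> 1 = 1 \<and>
     (\<forall>a. norm_positive a \<longrightarrow> \<Phi> a \<in> \<real>\<^sub>\<ge>\<^sub>0)"

text \<open>Failure of positivity means \<open>num_sup (- h) > 0\<close>, so a functional below
  \<open>num_sup\<close> that touches it at \<open>- h\<close> is negative at \<open>h\<close>.
  Domination by \<open>num_sup\<close> also makes it nonnegative on the cone, normalized at 1 and
  zero on \<open>\<i> *\<^sub>C k\<close> for self-adjoint \<open>k\<close>.\<close>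

lemma unital_state_separates:
  fixes h :: "'a::unital_cstar_algebra"
  assumes h: "star h = h" "\<not> norm_positive h"
  obtains \<Phi> where "unital_state \<Phi>" "Re (\<Phi> h) < 0"
proof -
  obtain f where f: "linear f" "\<And>x. f x \<le> num_sup x" "f (- h) = num_sup (- h)"
    using hahn_banach_sublinear[OF sublinear_num_sup] by metis
  have f_simps: "f (x + y) = f x + f y" "f (r *\<^sub>R x) = r * f x" "f (- x) = - f x" "f (x - y) = f x - f y" for x y r
    using f(1) by (simp_all add: linear_add linear_scale linear_neg linear_diff)
  have re_minus: "re_part (- x) = - re_part x" for x :: 'a using re_part_simps(2)[of "-1" x] by simp
  define \<Phi> where "\<Phi> x = Complex (f x) (- f (\<i> *\<^sub>C x))" for x
  have dec: "c *\<^sub>C x = Re c *\<^sub>R x + Im c *\<^sub>R (\<i> *\<^sub>C x)" for c and x :: 'a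
    by (simp add: scaleR_scaleC scaleC_scaleC flip: scaleC_add_left) (metis complex_eq mult.commute)
  have ii: "\<i> *\<^sub>C (\<i> *\<^sub>C x) = - x" for x :: 'a
    by (simp add: scaleC_scaleC complex_vector.scale_minus_left scaleC_one)
  have lin: "clinear \<Phi>"
  proof (rule clinearI)
    show "\<Phi> (x + y) = \<Phi> x + \<Phi> y" for x y
      by (simp add: \<Phi>_def complex_eq_iff f_simps scaleC_add_right)
    fix c x
    show "\<Phi> (c *\<^sub>C x) = c *\<^sub>C \<Phi> x"
      unfolding dec[of c x]
      by (simp add: \<Phi>_def complex_eq_iff f_simps scaleC_add_right scaleC_scaleR_commute ii
          scaleC_complex_def algebra_simps)
  qed
  have i0: "f (\<i> *\<^sub>C k) = 0" if "star k = k" for k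
  proof -
    have "num_sup (\<i> *\<^sub>C k) \<le> 0" "num_sup (- (\<i> *\<^sub>C k)) \<le> 0"
      by (simp_all add: num_sup_le_iff re_minus re_part_scaleC_i that norm_positive_scaleR_one[of 0, simplified])
    then show ?thesis using f(2)[of "\<i> *\<^sub>C k"] f(2)[of "- (\<i> *\<^sub>C k)"] by (simp add: f_simps)
  qed
  have pos: "0 \<le> f a" if "norm_positive a" for a
  proof -
    have "num_sup (- a) \<le> 0"
      using that by (simp add: num_sup_le_iff re_minus re_part_selfadjoint norm_positive_star)
    then show ?thesis using f(2)[of "- a"] by (simp add: f_simps)
  qed
  have "unital_state \<Phi>"
    unfolding unital_state_def
  proof (intro conjI allI impI lin)
    have "num_sup (- 1 :: 'a) \<le> - 1"
      by (simp add: num_sup_le_iff re_minus re_part_selfadjoint norm_positive_scaleR_one[of 0, simplified])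
    then have "f 1 = 1"
      using f(2)[of 1] f(2)[of "- 1"] num_sup_le_norm[of "1::'a"] by (simp add: f_simps)
    then show "\<Phi> 1 = 1" by (simp add: \<Phi>_def complex_eq_iff i0)
    show "\<Phi> a \<in> \<real>\<^sub>\<ge>\<^sub>0" if "norm_positive a" for a
      using pos[OF that] i0[OF norm_positive_star[OF that]]
      by (simp add: \<Phi>_def complex_nonneg_Reals_iff)
    fix x
    show "cmod (\<Phi> x) \<le> norm x"
    proof (cases "\<Phi> x = 0")
      case False
      \<comment> \<open>A phase that rotates the value to its modulus, so that the bound on the real
        part \<open>f\<close> bounds the modulus.\<close>
      define c where "c = cnj (\<Phi> x) / cmod (\<Phi> x)"
      have "cmod c = 1" using False by (simp add: c_def norm_divide)
      have "f (c *\<^sub>C x) = Re (\<Phi> (c *\<^sub>C x))" by (simp add: \<Phi>_def)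
      also have "\<Phi> (c *\<^sub>C x) = c * \<Phi> x" using clinearD(2)[OF lin] by (simp add: scaleC_complex_def)
      also have "c * \<Phi> x = (\<Phi> x * cnj (\<Phi> x)) / cmod (\<Phi> x)" by (simp add: c_def)
      also have "\<dots> = of_real ((cmod (\<Phi> x))\<^sup>2 / cmod (\<Phi> x))"
        by (simp only: complex_norm_square[symmetric] of_real_divide of_real_power)
      also have "(cmod (\<Phi> x))\<^sup>2 / cmod (\<Phi> x) = cmod (\<Phi> x)" by (simp add: power2_eq_square)
      finally have "cmod (\<Phi> x) = f (c *\<^sub>C x)" by simp
      also have "\<dots> \<le> norm (c *\<^sub>C x)" using f(2) num_sup_le_norm order_trans by blast
      finally show ?thesis by (simp add: norm_scaleC \<open>cmod c = 1\<close>)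
    qed simp
  qed
  moreover have "Re (\<Phi> h) < 0"
  proof (rule ccontr)
    assume "\<not> Re (\<Phi> h) < 0"
    then have "num_sup (- h) \<le> 0" using f(3) by (simp add: \<Phi>_def f_simps)
    then show False using h by (simp add: num_sup_le_iff re_minus re_part_selfadjoint)
  qed
  ultimately show thesis using that by blast
qed

lemma unital_state_selfadjoint_real:
  assumes "unital_state \<Phi>" "star h = h"
  shows "Im (\<Phi> h) = 0"
proof -
  have "\<Phi> (norm h *\<^sub>R 1 - h) \<in> \<real>\<^sub>\<ge>\<^sub>0"
    using assms norm_positive_norm_minus[of h "norm h"] by (simp add: unital_state_def)
  then show ?thesis
    using assms(1) by (simp add: unital_state_def clinearD complex_nonneg_Reals_iff)
qed

text \<open>Self-adjointness is part of the conclusion: every state vanishes on the imaginary part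
  \<open>k\<close>, so \<open>k\<close> and \<open>- k\<close> are both positive.\<close>

lemma norm_positive_if_states_nonneg:
  fixes x :: "'a::unital_cstar_algebra"
  assumes "\<And>\<Phi>. unital_state \<Phi> \<Longrightarrow> \<Phi> x \<in> \<real>\<^sub>\<ge>\<^sub>0"
  shows "norm_positive x"
proof -
  obtain h k where h: "star h = h" "star k = k" "x = h + \<i> *\<^sub>C k"
    using cartesian_decomposition[of x] by metis
  have val: "Re (\<Phi> h) \<ge> 0 \<and> Re (\<Phi> k) = 0" if "unital_state \<Phi>" for \<Phi>
  proof -
    have "\<Phi> x = \<Phi> h + \<i> * \<Phi> k" using that
      by (simp add: h(3) unital_state_def clinearD scaleC_complex_def)
    then show ?thesis
      using assms[OF that] unital_state_selfadjoint_real[OF that h(1)]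
        unital_state_selfadjoint_real[OF that h(2)] by (simp add: complex_nonneg_Reals_iff)
  qed
  have "norm_positive h"
    using unital_state_separates[OF h(1)] val by (metis not_less)
  moreover have "norm_positive k"
    using unital_state_separates[OF h(2)] val by (metis less_irrefl)
  moreover have "norm_positive (- k)"
  proof (rule ccontr)
    assume "\<not> norm_positive (- k)"
    then obtain \<Phi> where "unital_state \<Phi>" "Re (\<Phi> (- k)) < 0"
      using unital_state_separates[of "- k"] h(2) by (auto simp: star_minus)
    then show False using val[of \<Phi>] by (simp add: unital_state_def clinearD)
  qed
  ultimately have "k = 0" "norm_positive h" using norm_positive_antisym by blast+
  then show ?thesis by (simp add: h(3) complex_vector.scale_zero_right)
qed

section \<open>Positive functionals and the unitization\<close>

lemma Unitization_simps:
  "Unitization a 0 * Unitization b 0 = Unitization (a * b) 0"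
  "star (Unitization a 0) = Unitization (star a) 0"
  "Unitization a 0 + Unitization b 0 = Unitization (a + b) 0"
  "Unitization a 0 - Unitization b 0 = Unitization (a - b) 0"
  "c *\<^sub>C Unitization a 0 = Unitization (c *\<^sub>C a) 0"
  for a b :: "'a::cstar_algebra"
  by (rule unitization_eqI; simp add: complex_vector.scale_zero_left)+

text \<open>The element \<open>1 - x ^ n\<close> with \<open>x = 1 - (1/s) *\<^sub>R (Y * Y)\<close>
  commutes with \<open>Y\<close>, and the error is \<open>(1 + V) * (x ^ n * Y)\<close>. Since
  \<open>Y * Y = s *\<^sub>R (1 - x)\<close>, the squared norm of the last factor is at most
  \<open>s / Suc (2 * n)\<close>.\<close>

lemma approximate_unit:
  fixes y :: "'a::cstar_algebra"
  assumes y: "star y = y" and e: "e > 0"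
  obtains v where "star v = v" "norm v \<le> 1" "norm (y - v * y * v) \<le> e"
proof -
  define Y where "Y = Unitization y 0"
  have Y: "star Y = Y" by (simp add: Y_def Unitization_simps y)
  define s where "s = (norm Y)\<^sup>2 + 1"
  have s: "s > 0" by (simp add: s_def add_nonneg_pos)
  define g where "g = (1/s) *\<^sub>R (Y * Y)"
  have g: "norm_positive g" unfolding g_def using s by (intro norm_positive_scaleR norm_positive_square Y) simp
  have "norm (Y * Y) = (norm Y)\<^sup>2" by (rule cstar_identity_selfadjoint[OF Y])
  then have "norm g \<le> 1" using s by (simp add: g_def s_def)
  define x where "x = 1 - g"
  have x: "norm_positive x"
    using norm_positive_norm_minus[OF norm_positive_star[OF g] \<open>norm g \<le> 1\<close>] by (simp add: x_def)
  have "norm x \<le> 1"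
    by (rule norm_positive_norm_le[OF x]) (use g in \<open>simp_all add: x_def\<close>)
  have xY: "x * Y = Y * x" by (simp add: x_def g_def algebra_simps)
  have xnY: "x ^ n * Y = Y * x ^ n" for n
    by (induction n) (simp_all, metis mult.assoc xY)
  have xn: "norm_positive (x ^ n)" "norm (x ^ n) \<le> 1" for n
    using norm_positive_power[OF x] norm_power_ineq[of x n] power_le_one[of "norm x" n] \<open>norm x \<le> 1\<close>
    by auto
  have small: "(norm (x ^ n * Y))\<^sup>2 \<le> s / Suc (2 * n)" for n
  proof -
    have "star (x ^ n * Y) * (x ^ n * Y) = Y * (x ^ n * x ^ n) * Y"
      by (simp add: star_mult Y norm_positive_star[OF xn(1)] mult.assoc)
    also have "\<dots> = Y * x ^ (2 * n) * Y" by (simp add: mult_2 power_add)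
    also have "\<dots> = x ^ (2 * n) * (Y * Y)" by (simp add: mult.assoc flip: xnY)
    also have "Y * Y = s *\<^sub>R (1 - x)" using s by (simp add: x_def g_def)
    finally have "(norm (x ^ n * Y))\<^sup>2 = norm (s *\<^sub>R (x ^ (2 * n) * (1 - x)))"
      by (simp flip: cstar_identity)
    also have "\<dots> = s * norm (x ^ (2 * n) * (1 - x))" using s by simp
    also have "\<dots> \<le> s * (1 / Suc (2 * n))"
      using s by (intro mult_left_mono power_mult_one_minus_le x \<open>norm x \<le> 1\<close>) simp
    finally show ?thesis by simp
  qed
  obtain n :: nat where n: "s / (e/2)\<^sup>2 < real n" using reals_Archimedean2 by blast
  define V where "V = 1 - x ^ n"
  have "norm_positive V"
    using norm_positive_norm_minus[OF norm_positive_star[OF xn(1)] xn(2)] by (simp add: V_def)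
  have V: "star V = V" "norm V \<le> 1"
    using \<open>norm_positive V\<close> norm_positive_norm_le[OF \<open>norm_positive V\<close>, of 1] xn(1)
    by (simp_all add: norm_positive_star V_def)
  \<comment> \<open>The scalar part of \<open>V\<close> vanishes, which places the approximate unit
    in the original algebra.\<close>
  have "scal (x ^ n) = 1"
    by (induction n) (simp_all add: x_def g_def Y_def)
  then have scalV: "scal V = 0" by (simp add: V_def)
  define v where "v = elem V"
  have vV: "V = Unitization v 0" by (rule unitization_eqI) (simp_all add: v_def scalV)
  have VY: "V * Y = Y * V" by (simp add: V_def algebra_simps xnY)
  have "Y - V * Y * V = (1 + V) * (x ^ n * Y)"
  proof -
    have "V * Y * V = V * V * Y" by (metis VY mult.assoc)
    then have "Y - V * Y * V = (1 + V) * (1 - V) * Y" by (simp add: algebra_simps)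
    then show ?thesis by (simp add: V_def mult.assoc)
  qed
  then have "norm (Y - V * Y * V) \<le> norm (1 + V) * norm (x ^ n * Y)"
    by (simp only: norm_mult_ineq)
  also have "\<dots> \<le> 2 * (e / 2)"
  proof (intro mult_mono)
    show "norm (1 + V) \<le> 2" using norm_triangle_ineq[of 1 V] V by simp
    have "s < (e/2)\<^sup>2 * real n" using n e by (simp add: field_simps)
    also have "\<dots> \<le> (e/2)\<^sup>2 * real (Suc (2 * n))" by (intro mult_left_mono) simp_all
    finally have "s / Suc (2 * n) \<le> (e/2)\<^sup>2"
      by (simp only: pos_divide_le_eq of_nat_0_less_iff zero_less_Suc less_imp_le)
    then have "(norm (x ^ n * Y))\<^sup>2 \<le> (e/2)\<^sup>2" using small[of n] by linarith
    then show "norm (x ^ n * Y) \<le> e / 2" by (rule power2_le_imp_le) (use e in simp)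
  qed simp_all
  finally have "norm (y - v * y * v) \<le> e"
    by (simp add: Y_def vV Unitization_simps norm_Unitization)
  moreover have "star v = v" using V(1) by (simp add: vV Unitization_simps)
  moreover have "norm v \<le> 1" using V(2) by (simp add: vV norm_Unitization)
  ultimately show thesis using that by blast
qed

text \<open>Write \<open>G = H * H\<close> and compress by an approximate unit \<open>v\<close>.
  Then \<open>H * Unitization v 0\<close> lies in the original algebra as \<open>w\<close>, and
  \<open>\<phi> (elem G) + scal G\<close> is close to
  \<open>\<phi> (star w * w) + \<mu> * (1 - \<phi> (v * v))\<close>, whose second term is
  nonnegative because \<open>\<phi>\<close> and \<open>v\<close> are contractive.\<close>

lemma positive_functional_extends:
  fixes \<phi> :: "'a::cstar_algebra \<Rightarrow> complex"
  assumes lin: "clinear \<phi>" and bound: "\<And>x. cmod (\<phi> x) \<le> norm x"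
    and pos: "\<And>x. \<phi> (star x * x) \<in> \<real>\<^sub>\<ge>\<^sub>0" and G: "norm_positive G"
  shows "\<phi> (elem G) + scal G \<in> \<real>\<^sub>\<ge>\<^sub>0"
proof -
  obtain H where H: "star H = H" "H * H = G" using norm_positive_sqrt[OF G] by metis
  define \<mu> where "\<mu> = (cmod (scal H))\<^sup>2"
  have "cnj (scal H) = scal H" using arg_cong[OF H(1), of scal] by simp
  then have scalG: "scal G = of_real \<mu>"
    using complex_norm_square[of "scal H"] by (simp add: \<mu>_def flip: H(2))
  have y: "star (elem G) = elem G" using arg_cong[OF norm_positive_star[OF G], of elem] by simp
  have "\<exists>r\<in>\<real>\<^sub>\<ge>\<^sub>0. dist r (\<phi> (elem G) + scal G) < e" if "e > 0" for e
  proof -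
    obtain v where v: "star v = v" "norm v \<le> 1" "norm (elem G - v * elem G * v) \<le> e/2"
      using approximate_unit[OF y, of "e/2"] \<open>e > 0\<close> by auto
    define w where "w = elem (H * Unitization v 0)"
    have "Unitization w 0 = H * Unitization v 0" by (rule unitization_eqI) (simp_all add: w_def)
    then have "Unitization (star w * w) 0 = star (H * Unitization v 0) * (H * Unitization v 0)"
      by (simp flip: Unitization_simps)
    also have "\<dots> = Unitization v 0 * G * Unitization v 0"
      by (simp add: star_mult H(1) Unitization_simps(2) v(1) mult.assoc flip: H(2))
    finally have "elem (Unitization (star w * w) 0) = elem (Unitization v 0 * G * Unitization v 0)"
      by (rule arg_cong)
    then have ww: "star w * w = v * elem G * v + \<mu> *\<^sub>R (v * v)"
      by (simp add: scalG scaleR_scaleC algebra_simps scaleC_simps complex_vector.scale_zero_left)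
    have vv: "\<phi> (v * v) \<in> \<real>\<^sub>\<ge>\<^sub>0" using pos[of v] by (simp add: v)
    have "cmod (\<phi> (v * v)) \<le> norm v * norm v"
      using bound[of "v * v"] norm_mult_ineq[of v v] by linarith
    then have "cmod (\<phi> (v * v)) \<le> 1" using v(2) mult_le_one[of "norm v" "norm v"] by simp
    then have "Re (\<phi> (v * v)) \<le> 1" using complex_Re_le_cmod order_trans by blast
    define r where "r = \<phi> (star w * w) + \<mu> * (1 - \<phi> (v * v))"
    have "r \<in> \<real>\<^sub>\<ge>\<^sub>0"
      unfolding r_def using vv \<open>Re (\<phi> (v * v)) \<le> 1\<close>
      by (intro nonneg_Reals_add_I nonneg_Reals_mult_I pos) (auto simp: complex_nonneg_Reals_iff \<mu>_def)
    moreover have "\<phi> (elem G) + scal G - r = \<phi> (elem G - v * elem G * v)"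
      by (simp add: r_def ww clinearD[OF lin] scalG scaleR_conv_of_real algebra_simps)
    then have "dist r (\<phi> (elem G) + scal G) \<le> e/2"
      using bound[of "elem G - v * elem G * v"] v(3) by (simp add: dist_norm norm_minus_commute[of r])
    ultimately show ?thesis using \<open>e > 0\<close> by (intro bexI[of _ r]) auto
  qed
  then show ?thesis using closed_approachable[OF closed_nonneg_Reals_complex] by blast
qed

text \<open>The assumption on the projection concerns functionals of norm exactly one; this rescales
  a restricted functional to reach it.\<close>

lemma positive_functional_scaled_state:
  fixes \<phi> :: "'a::cstar_algebra \<Rightarrow> complex"
  assumes lin: "clinear \<phi>" and bound: "\<And>x. cmod (\<phi> x) \<le> norm x"
    and pos: "\<And>x. \<phi> (star x * x) \<in> \<real>\<^sub>\<ge>\<^sub>0" and nz: "\<phi> x0 \<noteq> 0"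
  obtains c \<psi> where "0 < c" "c \<le> 1" "\<psi> \<in> states" "\<And>x. \<phi> x = of_real c * \<psi> x"
proof -
  have bl: "bounded_linear \<phi>"
    by (rule bounded_linear_intro[where K = 1]) (simp_all add: clinearD[OF lin] bound)
  define c where "c = onorm \<phi>"
  have "c > 0" using onorm_pos_lt[OF bl] nz by (auto simp: c_def)
  have "c \<le> 1" unfolding c_def by (rule onorm_bound) (simp_all add: bound)
  define \<psi> where "\<psi> x = (1/c) *\<^sub>R \<phi> x" for x
  have "clinear \<psi>"
    by (rule clinearI) (simp_all add: \<psi>_def clinearD[OF lin] scaleC_complex_def algebra_simps)
  moreover have "bounded_linear \<psi>"
    unfolding \<psi>_def by (intro bounded_linear_scaleR_right bl bounded_linear_const_scaleR)
  moreover have "onorm \<psi> = 1"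
    unfolding \<psi>_def using onorm_scaleR[OF bl, of "1/c"] \<open>c > 0\<close> by (simp add: c_def)
  moreover have "\<psi> G \<in> \<real>\<^sub>\<ge>\<^sub>0" if "positive G" for G
    using that pos \<open>c > 0\<close> by (auto simp: positive_def \<psi>_def complex_nonneg_Reals_iff)
  ultimately have "\<psi> \<in> states"
    by (auto simp: states_def positive_functional_def dual_def)
  moreover have "\<phi> x = of_real c * \<psi> x" for x
    using \<open>c > 0\<close> by (simp add: \<psi>_def scaleR_conv_of_real)
  ultimately show thesis using that \<open>c > 0\<close> \<open>c \<le> 1\<close> by blast
qed

definition unitization_map :: "('a::cstar_algebra \<Rightarrow> 'a) \<Rightarrow> 'a unitization \<Rightarrow> 'a unitization" where
  "unitization_map P u = Unitization (P (elem u)) (scal u)"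

lemma norm_positive_unitization_map:
  fixes P :: "'a::cstar_algebra \<Rightarrow> 'a"
  assumes P: "clinear P" "(\<lambda>\<phi>. \<phi> \<circ> P) ` states \<subseteq> states" and G: "norm_positive G"
  shows "norm_positive (unitization_map P G)"
proof (rule norm_positive_if_states_nonneg)
  fix \<Phi> :: "'a unitization \<Rightarrow> complex"
  assume \<Phi>: "unital_state \<Phi>"
  define \<phi> where "\<phi> x = \<Phi> (Unitization x 0)" for x
  have \<Phi>_lin: "clinear \<Phi>" using \<Phi> by (simp add: unital_state_def)
  have lin: "clinear \<phi>"
    by (rule clinearI) (simp_all add: \<phi>_def clinearD[OF \<Phi>_lin] flip: Unitization_simps)
  have bound: "cmod (\<phi> x) \<le> norm x" for x
    using \<Phi> norm_Unitization[of x] unfolding \<phi>_def unital_state_def by metis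
  have pos: "\<phi> (star x * x) \<in> \<real>\<^sub>\<ge>\<^sub>0" for x
    using \<Phi> norm_positive_star_mult_self[of "Unitization x 0"]
    by (simp add: \<phi>_def unital_state_def Unitization_simps)
  have lin': "clinear (\<lambda>x. \<phi> (P x))"
    by (rule clinearI) (simp_all add: clinearD[OF lin] clinearD[OF P(1)])
  have "cmod (\<phi> (P x)) \<le> norm x \<and> \<phi> (P (star x * x)) \<in> \<real>\<^sub>\<ge>\<^sub>0" for x
  \<comment> \<open>A state such as \<open>scal\<close> restricts to zero and cannot be rescaled;
    both claims are then trivial.\<close>
  proof (cases "\<exists>x0. \<phi> x0 \<noteq> 0")
    case True
    then obtain c \<psi> where \<psi>: "0 < c" "c \<le> 1" "\<psi> \<in> states" "\<And>x. \<phi> x = of_real c * \<psi> x"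
      using positive_functional_scaled_state[OF lin bound pos] by metis
    have st: "\<psi> \<circ> P \<in> states" using P(2) \<psi>(3) by blast
    then have "cmod ((\<psi> \<circ> P) x) \<le> norm x"
      using onorm[of "\<psi> \<circ> P" x] by (simp add: states_def positive_functional_def dual_def)
    then have "c * cmod (\<psi> (P x)) \<le> 1 * norm x"
      using \<psi>(1,2) by (intro mult_mono) auto
    moreover have "(\<psi> \<circ> P) (star x * x) \<in> \<real>\<^sub>\<ge>\<^sub>0"
      using st by (auto simp: states_def positive_functional_def positive_def)
    ultimately show ?thesis using \<psi>(1)
      by (auto simp: \<psi>(4) norm_mult complex_nonneg_Reals_iff)
  qed auto
  then have "\<phi> (P (elem G)) + scal G \<in> \<real>\<^sub>\<ge>\<^sub>0"
    using positive_functional_extends[OF lin' _ _ G] by blast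
  moreover have "unitization_map P G = Unitization (P (elem G)) 0 + scal G *\<^sub>C 1"
    by (rule unitization_eqI) (simp_all add: unitization_map_def complex_vector.scale_zero_right)
  then have "\<Phi> (unitization_map P G) = \<phi> (P (elem G)) + scal G"
    using \<Phi> by (simp add: clinearD[OF \<Phi>_lin] \<phi>_def unital_state_def scaleC_complex_def)
  ultimately show "\<Phi> (unitization_map P G) \<in> \<real>\<^sub>\<ge>\<^sub>0" by simp
qed

theorem corollary1:
  fixes P :: "'a::cstar_algebra \<Rightarrow> 'a" and B :: "'a set"
  assumes "linear_projection P"
    and "(\<lambda>\<phi>. \<phi> \<circ> P) ` states \<subseteq> states"
    and "cstar_subalgebra B"
    and "range P = B"
  shows "conditional_expectation P B"
proof -
  have P: "clinear P" "\<And>x. P (P x) = P x"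
    using assms(1) by (auto simp: linear_projection_def fun_eq_iff)
  have fixB: "P b = b \<longleftrightarrow> b \<in> B" for b using P(2) assms(4) by (metis imageE rangeI)
  let ?E = "unitization_map P"
  interpret E: unital_positive_projection ?E
  proof
    show "?E (u + v) = ?E u + ?E v" "?E (c *\<^sub>C u) = c *\<^sub>C ?E u" for u v c
      by (rule unitization_eqI; simp add: unitization_map_def clinearD[OF P(1)])+
    show "?E (?E u) = ?E u" for u by (simp add: unitization_map_def P(2))
    show "?E 1 = 1" by (rule unitization_eqI) (simp_all add: unitization_map_def clinearD[OF P(1)])
    show "norm_positive (?E a)" if "norm_positive a" for a
      by (rule norm_positive_unitization_map[OF P(1) assms(2) that])
    fix u v assume "?E u = u" "?E v = v"
    then have "elem u \<in> B" "elem v \<in> B"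
      by (metis fixB unitization.sel(1) unitization_map_def)+
    then have "elem (u * v) \<in> B"
      using assms(3) by (simp add: cstar_subalgebra_def complex_vector.subspace_add
          complex_vector.subspace_scale)
    then show "?E (u * v) = u * v"
      using fixB by (intro unitization_eqI) (simp_all add: unitization_map_def)
  qed
  have E_embed: "?E (Unitization a 0) = Unitization (P a) 0" for a by (simp add: unitization_map_def)
  have E_fix: "?E (Unitization b 0) = Unitization b 0" if "b \<in> B" for b
    using that fixB by (simp add: E_embed)
  show ?thesis
    unfolding conditional_expectation_def
  proof (intro conjI allI impI ballI assms)
    fix G :: 'a assume "positive G"
    then obtain H where "G = star H * H" by (auto simp: positive_def)
    then have "norm_positive (Unitization G 0)"
      using norm_positive_star_mult_self[of "Unitization H 0"] by (simp add: Unitization_simps)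
    then obtain K where K: "star K = K" "K * K = Unitization (P G) 0"
      using norm_positive_sqrt[OF E.pos] E_embed by metis
    \<comment> \<open>The root of \<open>P G\<close> is taken in the unitization; its vanishing
      scalar part shows that it belongs to the original algebra.\<close>
    have "scal K = 0" using arg_cong[OF K(2), of scal] by simp
    then have "P G = star (elem K) * elem K"
      using arg_cong[OF K(2), of elem] arg_cong[OF K(1), of elem]
      by (simp add: complex_vector.scale_zero_left)
    then show "positive (P G)" by (auto simp: positive_def)
  next
    show "norm (P a) \<le> norm a" for a
      using E.contraction[of "Unitization a 0"] by (simp add: E_embed norm_Unitization)
  next
    fix a b b' assume b: "b \<in> B" "b' \<in> B"
    have "?E (Unitization b 0 * Unitization a 0 * Unitization b' 0)
        = Unitization b 0 * ?E (Unitization a 0) * Unitization b' 0"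
      by (simp only: E.module_right[OF E_fix[OF b(2)]] E.module_left[OF E_fix[OF b(1)]])
    then show "P (b * a * b') = b * P a * b'" by (simp add: E_embed Unitization_simps)
  qed
qed

end
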